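(* Let $B>1$, let $p\ge 1$ be an integer, and let $T$ be a random field on $S^2$ as described in the context whose angular power spectrum $\{C_l\}$ satisfies the regularity condition (R) of the context with parameters $\alpha>2$ and $M\in\mathbb{N}$; let $c_0$ be the corresponding constant in (R) for this $B$. Assume that $\alpha>4p+2$. Then for every $\varepsilon\in(0,1)$ there exists a positive $\delta\le\varepsilon\left(1+c_0^2\right)^{-1/(\alpha-4p-2)}$ such that $$\liminf_{j\to\infty}\mathrm{Corr}\left(\beta_{jk;p},\beta_{jk';p}\right)>1-\varepsilon$$ for all $\{\xi_{jk},\xi_{jk'}\}$ such that $d(\xi_{jk},\xi_{jk'})\le\delta$ (that is, for every choice of pairs of indices $k=k_j$, $k'=k'_j$, one pair for each $j$, with $d(\xi_{jk},\xi_{jk'})\le\delta$ for all $j$).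
   Context: Random field. $T$ is a real-valued, zero-mean, finite-variance, mean-square continuous, isotropic random field on the unit sphere $S^2$, with spectral representation (in the mean-square sense) $T(x)=\sum_{l\ge 0}\sum_{m=-l}^{l}a_{lm}Y_{lm}(x)$, $x\in S^2$. Here $\{Y_{lm}\}$ are the standard spherical harmonics (an orthonormal basis of $L^2(S^2)$ with $\Delta_{S^2}Y_{lm}=-l(l+1)Y_{lm}$), and $\{a_{lm}\}$ is a triangular array of zero-mean, orthogonal random variables (complex-valued for $m\neq 0$) with $\mathbb{E}|a_{lm}|^2=C_l$. The sequence $\{C_l\}$ is the angular power spectrum; mean-square continuity entails $\sum_l(2l+1)C_l<\infty$. Regularity condition (R) with parameters $\alpha>2$ and $M\in\mathbb{N}$: for every $B>1$ there exist a sequence of functions $\{g_j\}_{j=1,2,\dots}$ and constants $c_0,c_1,\dots,c_M>0$ such that $$C_l=l^{-\alpha}g_j\left(\frac{l}{B^j}\right)>0\quad\text{for } B^{j-1}<l<B^{j+1},\ j=1,2,\dots,$$ where $c_0^{-1}\le g_j\le c_0$ for all $j\in\mathbb{N}$, and $\sup_j\sup_{B^{-1}\le u\le B}\left|\frac{d^r}{du^r}g_j(u)\right|\le c_r$ for $r=1,\dots,M$. Mexican needlet coefficients. For each scale $j$, $\{\xi_{jk}\}_k$ is a finite set of points of $S^2$ and $\{\lambda_{jk}\}_k$ are associated positive weights. The Mexican needlet of order $p$ is $$\psi_{jk;p}(x)=\sqrt{\lambda_{jk}}\sum_{l\ge1}\left(\frac{l(l+1)}{B^{2j}}\right)^{p}e^{-l(l+1)/B^{2j}}\sum_{m=-l}^{l}Y_{lm}(\xi_{jk})\overline{Y_{lm}(x)},$$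 and the random Mexican needlet coefficients are $$\beta_{jk;p}=\int_{S^2}T(x)\psi_{jk;p}(x)\,dx=\sqrt{\lambda_{jk}}\sum_{l\ge1}\left(\frac{l(l+1)}{B^{2j}}\right)^{p}e^{-l(l+1)/B^{2j}}\sum_{m=-l}^{l}a_{lm}Y_{lm}(\xi_{jk}).$$ The correlation of two such coefficients is $\mathrm{Corr}(\beta,\beta')=\mathbb{E}[\beta\beta']/\sqrt{\mathbb{E}[\beta^2]\,\mathbb{E}[\beta'^2]}$. The distance on the sphere is $d(\xi,\eta)=\arccos\langle\xi,\eta\rangle$. *)

theory Defs
  imports "HOL-Probability.Probability" "HOL-Computational_Algebra.Polynomial"
begin

abbreviation S2 :: "(real^3) set" where
  "S2 \<equiv> sphere 0 1"

definition sphere_dist :: "real^3 \<Rightarrow> real^3 \<Rightarrow> real" where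
  "sphere_dist x y = arccos (x \<bullet> y)"

definition sphere_point :: "real \<times> real \<Rightarrow> real^3" where
  "sphere_point = (\<lambda>(\<theta>, \<phi>). vector [sin \<theta> * cos \<phi>, sin \<theta> * sin \<phi>, cos \<theta>])"

text \<open>Surface area: the image of \<open>sin \<theta> d\<theta> d\<phi>\<close> on \<open>[0,\<pi>] \<times> [0,2\<pi>]\<close>; it is not normalised
  (total mass \<open>4\<pi>\<close>).\<close>

definition sphere_measure :: "(real^3) measure" where
  "sphere_measure =
     distr (density lborel
              (\<lambda>(\<theta>, \<phi>). indicator ({0..pi} \<times> {0..2 * pi}) (\<theta>, \<phi>) * ennreal (sin \<theta>)))
       (restrict_space borel S2) sphere_point"

text \<open>Rodrigues' formula\<close>

definition legendre_poly :: "nat \<Rightarrow> real poly" where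
  "legendre_poly l = smult (1 / (2 ^ l * fact l)) ((pderiv ^^ l) ([:-1, 0, 1:] ^ l))"

text \<open>With the Condon--Shortley phase \<open>(-1)\<^sup>m\<close>; \<open>sqrt (1 - t\<^sup>2) ^ m\<close> is \<open>(1 - t\<^sup>2)\<close> to the power \<open>m/2\<close>.\<close>

definition assoc_legendre :: "nat \<Rightarrow> nat \<Rightarrow> real \<Rightarrow> real" where
  "assoc_legendre l m t =
     (-1) ^ m * sqrt (1 - t\<^sup>2) ^ m * poly ((pderiv ^^ m) (legendre_poly l)) t"

text \<open>At \<open>x = sphere_point (\<theta>, \<phi>)\<close> one has \<open>cos \<theta> = x $ 3\<close>, and \<open>\<phi>\<close> is the argument of
  \<open>x $ 1 + \<i> * x $ 2\<close>. At the poles \<open>\<phi>\<close> is irrelevant, since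
  \<open>assoc_legendre l m (\<plusminus>1) = 0\<close> for \<open>m > 0\<close>.\<close>

definition sph_harm_nonneg :: "nat \<Rightarrow> nat \<Rightarrow> real^3 \<Rightarrow> complex" where
  "sph_harm_nonneg l m x =
     of_real (sqrt ((2 * real l + 1) / (4 * pi) * (fact (l - m) / fact (l + m)))
              * assoc_legendre l m (x $ 3))
     * cis (real m * Arg (Complex (x $ 1) (x $ 2)))"

definition sph_harm :: "nat \<Rightarrow> int \<Rightarrow> real^3 \<Rightarrow> complex" where
  "sph_harm l m x =
     (if 0 \<le> m then sph_harm_nonneg l (nat m) x
      else (-1) ^ nat (-m) * cnj (sph_harm_nonneg l (nat (-m)) x))"

text \<open>
  Isotropy is invariance of the second-order structure under rotations, which for a zero-mean,
  finite-variance field is implied by invariance of its law.  Joint measurability makes the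
  integrals over the sphere that define the needlet coefficients meaningful.\<close>

locale isotropic_field = prob_space P
  for P :: "'w measure"
    and T :: "real^3 \<Rightarrow> 'w \<Rightarrow> real"
    and a :: "nat \<Rightarrow> int \<Rightarrow> 'w \<Rightarrow> complex"
    and C :: "nat \<Rightarrow> real" +
  assumes measurable_field:
      "(\<lambda>(x, \<omega>). T x \<omega>) \<in> borel_measurable (sphere_measure \<Otimes>\<^sub>M P)"
    and finite_variance: "x \<in> S2 \<Longrightarrow> integrable P (\<lambda>\<omega>. (T x \<omega>)\<^sup>2)"
    and zero_mean: "x \<in> S2 \<Longrightarrow> (\<integral>\<omega>. T x \<omega> \<partial>P) = 0"
    and mean_square_continuous:
      "x \<in> S2 \<Longrightarrow> ((\<lambda>y. \<integral>\<omega>. (T y \<omega> - T x \<omega>)\<^sup>2 \<partial>P) \<longlongrightarrow> 0) (at x within S2)"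
    and isotropic:
      "rotation_matrix Q \<Longrightarrow> x \<in> S2 \<Longrightarrow> y \<in> S2 \<Longrightarrow>
         (\<integral>\<omega>. T (Q *v x) \<omega> * T (Q *v y) \<omega> \<partial>P) = (\<integral>\<omega>. T x \<omega> * T y \<omega> \<partial>P)"
    and coeff_measurable: "\<bar>m\<bar> \<le> int l \<Longrightarrow> a l m \<in> borel_measurable P"
    and coeff_square_integrable: "\<bar>m\<bar> \<le> int l \<Longrightarrow> integrable P (\<lambda>\<omega>. (cmod (a l m \<omega>))\<^sup>2)"
    and coeff_zero_mean: "\<bar>m\<bar> \<le> int l \<Longrightarrow> (\<integral>\<omega>. a l m \<omega> \<partial>P) = 0"
    and coeff_real: "AE \<omega> in P. a l 0 \<omega> \<in> \<real>"
    and coeff_orthogonal: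
      "\<bar>m\<bar> \<le> int l \<Longrightarrow> \<bar>m'\<bar> \<le> int l' \<Longrightarrow> (l, m) \<noteq> (l', m') \<Longrightarrow>
         (\<integral>\<omega>. a l m \<omega> * cnj (a l' m' \<omega>) \<partial>P) = 0"
    and angular_power_spectrum:
      "\<bar>m\<bar> \<le> int l \<Longrightarrow> (\<integral>\<omega>. (cmod (a l m \<omega>))\<^sup>2 \<partial>P) = C l"
    and spectral_representation:
      "x \<in> S2 \<Longrightarrow>
         (\<lambda>L. \<integral>\<omega>. (cmod (of_real (T x \<omega>)
                 - (\<Sum>l\<le>L. \<Sum>m = - int l..int l. a l m \<omega> * sph_harm l m x)))\<^sup>2 \<partial>P)
           \<longlonglongrightarrow> 0"

text \<open>
  \<open>D j r\<close> is the \<open>r\<close>-th derivative of \<open>g j\<close> on \<open>[1/B, B]\<close>, one-sided at the endpoints; the bounds on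
  the suprema are written pointwise.\<close>

definition regular_at ::
    "real \<Rightarrow> real \<Rightarrow> nat \<Rightarrow> (nat \<Rightarrow> real) \<Rightarrow> (nat \<Rightarrow> real \<Rightarrow> real) \<Rightarrow> (nat \<Rightarrow> real) \<Rightarrow> bool" where
  "regular_at B \<alpha> M C g c \<longleftrightarrow>
     (\<forall>r\<le>M. 0 < c r) \<and>
     (\<forall>j\<ge>1. \<forall>l. B ^ (j - 1) < real l \<and> real l < B ^ (j + 1) \<longrightarrow>
        C l = real l powr (-\<alpha>) * g j (real l / B ^ j) \<and> 0 < C l) \<and>
     (\<forall>j\<ge>1. \<forall>u\<in>{1 / B..B}. 1 / c 0 \<le> g j u \<and> g j u \<le> c 0) \<and>
     (\<exists>D. \<forall>j\<ge>1. D j 0 = g j \<and>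
        (\<forall>r<M. \<forall>u\<in>{1 / B..B}.
           (D j r has_real_derivative D j (Suc r) u) (at u within {1 / B..B})) \<and>
        (\<forall>r\<in>{1..M}. \<forall>u\<in>{1 / B..B}. \<bar>D j r u\<bar> \<le> c r))"

definition regular_spectrum :: "real \<Rightarrow> nat \<Rightarrow> (nat \<Rightarrow> real) \<Rightarrow> bool" where
  "regular_spectrum \<alpha> M C \<longleftrightarrow> (\<forall>B>1. \<exists>g c. regular_at B \<alpha> M C g c)"

text \<open>Here \<open>\<xi>\<close> and \<open>w\<close> are the point and the weight of a single needlet.\<close>

definition mexican_needlet ::
    "real \<Rightarrow> nat \<Rightarrow> nat \<Rightarrow> real^3 \<Rightarrow> real \<Rightarrow> real^3 \<Rightarrow> complex" where
  "mexican_needlet B p j \<xi> w x =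
     of_real (sqrt w) *
     (\<Sum>\<^sub>\<infinity>l\<in>{1..}.
        of_real ((real (l * (l + 1)) / B ^ (2 * j)) ^ p * exp (- (real (l * (l + 1)) / B ^ (2 * j))))
        * (\<Sum>m = - int l..int l. sph_harm l m \<xi> * cnj (sph_harm l m x)))"

text \<open>The needlet is real-valued, because \<open>sph_harm l (-m) x = (-1)\<^sup>m * cnj (sph_harm l m x)\<close>;
  \<open>Re\<close> only changes the type.\<close>

definition needlet_coeff ::
    "(real^3 \<Rightarrow> 'w \<Rightarrow> real) \<Rightarrow> real \<Rightarrow> nat \<Rightarrow> nat \<Rightarrow> real^3 \<Rightarrow> real \<Rightarrow> 'w \<Rightarrow> real" where
  "needlet_coeff T B p j \<xi> w \<omega> =
     Re (\<integral>x. of_real (T x \<omega>) * mexican_needlet B p j \<xi> w x \<partial>sphere_measure)"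

definition Corr :: "'w measure \<Rightarrow> ('w \<Rightarrow> real) \<Rightarrow> ('w \<Rightarrow> real) \<Rightarrow> real" where
  "Corr P X Y =
     (\<integral>\<omega>. X \<omega> * Y \<omega> \<partial>P) / sqrt ((\<integral>\<omega>. (X \<omega>)\<^sup>2 \<partial>P) * (\<integral>\<omega>. (Y \<omega>)\<^sup>2 \<partial>P))"

end

theory Submission
  imports Defs
begin

text \<open>A needlet coefficient is the field integrated against a zonal function, so all second moments are
  diagonal in the degree \<open>l\<close>. Write \<open>Z\<^sub>l\<close> for the reproducing kernel of degree \<open>l\<close>, \<open>s\<^sub>l =
  (2 l + 1) / (4 \<pi>)\<close> for its constant value on the diagonal, and \<open>u\<^sub>l = (l (l + 1))\<^sup>2\<^sup>p C\<^sub>l\<close>.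
  Quadrature weights and powers of \<open>B\<close> cancel in the correlation, which becomes

  \<open>(\<Sum>l. u\<^sub>l e\<^sub>j\<^sub>l Z\<^sub>l(\<xi>, \<xi>')) / (\<Sum>l. u\<^sub>l e\<^sub>j\<^sub>l s\<^sub>l)\<close>, where \<open>e\<^sub>j\<^sub>l = exp (- 2 l (l + 1) / B\<^sup>2\<^sup>j)\<close>.

  The hypothesis \<open>\<alpha> > 4 p + 2\<close> makes \<open>\<Sum>l. u\<^sub>l s\<^sub>l\<close> converge: low degrees dominate, however large
  \<open>j\<close> is, and they cannot resolve two nearby points. Precisely, one minus the correlation is at most
  a constant times \<open>G(\<xi>, \<xi>') = \<Sum>l. u\<^sub>l (s\<^sub>l - Z\<^sub>l(\<xi>, \<xi>'))\<close>, with a constant independent of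
  \<open>j\<close> and of the points (\<open>Corr_needlet_coeff_ge\<close>). By uniform convergence \<open>G\<close> is continuous on
  \<open>S\<^sup>2 \<times> S\<^sup>2\<close>; it vanishes on the diagonal, and compactness gives a \<open>\<delta>\<close> that serves for all pairs
  at once (\<open>zonal_gap_uniformly_small\<close>). Since \<open>\<delta>\<close> may be decreased, the required upper bound on it
  is obtained by taking a minimum, and the inequality holds for every \<open>j \<ge> 1\<close>, not merely in the limit.

  Two ingredients carry the reduction to series. On the analytic side, the kernels satisfy
  \<open>Z\<^sub>l(x, x) = s\<^sub>l\<close> and reproduce themselves under integration. The former is Unsoeld's identity, obtained
  from the Legendre differential equation by a telescoping derivative (\<open>legendre_unsoeld\<close>); the latter is
  orthonormality of the harmonics (\<open>sph_harm_orthonormal\<close>), whose normalisation \<open>2 / (2 l + 1)\<close>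
  in turn comes from integrating Unsoeld's identity. On the probabilistic side, the spectral representation
  gives the covariance \<open>\<Sum>l. C\<^sub>l Z\<^sub>l(x, y)\<close> (\<open>covariance_eq\<close>), and Fubini's theorem moves the
  expectation inside the integrals that define the coefficients (\<open>expectation_smear_mult\<close>).\<close>

section \<open>Legendre polynomials and their derivatives\<close>

lemma pderiv_power_rodrigues:
  "[:-1, 0, 1:] * pderiv ([:-1, 0, 1:] ^ l) = smult (2 * real l) ([:0, 1:] * [:-1, 0, 1:] ^ l)"
proof (cases l)
  case (Suc n)
  show ?thesis
    unfolding Suc pderiv_power_Suc
    by (rule poly_eq_poly_eq_iff[THEN iffD1], rule ext) (simp add: pderiv_pCons algebra_simps)
qed auto

text \<open>Repeated differentiation of \<open>(t\<^sup>2 - 1) w' = 2 l t w\<close>, the equation that characterises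
  \<open>w = (t\<^sup>2 - 1)\<^sup>l\<close>. Each further derivative of the left-hand side produces only two
  extra terms because \<open>t\<^sup>2 - 1\<close> is quadratic.\<close>

lemma rodrigues_ode:
  fixes l k :: nat
  defines "w \<equiv> [:-1, 0, 1 :: real:] ^ l"
  shows "[:-1, 0, 1:] * (pderiv ^^ (k + 2)) w =
           smult (2 * (real l - real k - 1)) ([:0, 1:] * (pderiv ^^ (k + 1)) w)
         + smult ((real k + 1) * (2 * real l - real k)) ((pderiv ^^ k) w)"
proof -
  define q X where "q = [:-1, 0, 1 :: real:]" and "X = [:0, 1 :: real:]"
  have q' [simp]: "pderiv q = smult 2 X" "poly q t = t\<^sup>2 - 1" for t
    by (simp_all add: q_def X_def pderiv_pCons power2_eq_square)
  have X' [simp]: "pderiv X = 1" "poly X t = t" for t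
    by (simp_all add: X_def pderiv_pCons)
  note d = pderiv_mult pderiv_smult pderiv_add
  define W where "W k = (pderiv ^^ k) w" for k
  have W' [simp]: "pderiv (W k) = W (Suc k)" for k by (simp add: W_def)
  have "q * W (Suc (Suc k)) = smult (2 * (real l - real k - 1)) (X * W (Suc k))
      + smult ((real k + 1) * (2 * real l - real k)) (W k)"
  proof (induction k)
    case 0
    have "q * W 1 = smult (2 * real l) (X * W 0)"
      unfolding W_def w_def q_def X_def by (simp only: pderiv_power_rodrigues One_nat_def funpow.simps o_apply id_apply)
    then have "pderiv (q * W 1) = pderiv (smult (2 * real l) (X * W 0))" by simp
    then have "poly (pderiv (q * W 1)) t = poly (pderiv (smult (2 * real l) (X * W 0))) t" for t
      by simp
    then have "poly (q * W (Suc (Suc 0))) t = poly (smult (2 * (real l - real 0 - 1)) (X * W (Suc 0))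
        + smult ((real 0 + 1) * (2 * real l - real 0)) (W 0)) t" for t
      by (simp add: d algebra_simps)
    then show ?case by (intro poly_eq_poly_eq_iff[THEN iffD1] ext)
  next
    case (Suc k)
    then have "poly (pderiv (q * W (Suc (Suc k)))) t = poly (pderiv
        (smult (2 * (real l - real k - 1)) (X * W (Suc k))
        + smult ((real k + 1) * (2 * real l - real k)) (W k))) t" for t by simp
    then have "poly (q * W (Suc (Suc (Suc k)))) t =
        poly (smult (2 * (real l - real (Suc k) - 1)) (X * W (Suc (Suc k)))
        + smult ((real (Suc k) + 1) * (2 * real l - real (Suc k))) (W (Suc k))) t" for t
      by (simp add: d algebra_simps)
    then show ?case by (intro poly_eq_poly_eq_iff[THEN iffD1] ext)
  qed
  then show ?thesis by (simp add: q_def X_def W_def numeral_2_eq_2 del: mult_pCons_left)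
qed

definition legendre_deriv :: "nat \<Rightarrow> nat \<Rightarrow> real \<Rightarrow> real" where
  "legendre_deriv l m t = poly ((pderiv ^^ m) (legendre_poly l)) t"

lemma has_derivative_legendre_deriv [derivative_intros]:
  "(legendre_deriv l m has_real_derivative legendre_deriv l (Suc m) t) (at t within A)"
  unfolding legendre_deriv_def by (auto intro: has_field_derivative_at_within)

lemma continuous_on_legendre_deriv [continuous_intros]:
  "continuous_on A f \<Longrightarrow> continuous_on A (\<lambda>x. legendre_deriv l m (f x))"
  unfolding legendre_deriv_def by (intro continuous_intros)

lemma higher_pderiv_legendre_poly:
  "(pderiv ^^ m) (legendre_poly l) = smult (1 / (2 ^ l * fact l)) ((pderiv ^^ (l + m)) ([:-1, 0, 1:] ^ l))"
  by (simp add: legendre_poly_def higher_pderiv_smult funpow_add add.commute[of l m])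

text \<open>The differential equation of the \<open>m\<close>-th derivative of \<open>P\<^sub>l\<close>. It is used in two ways below:
  as a recurrence that links three consecutive derivatives, and, multiplied by the weight
  \<open>(1 - t\<^sup>2)\<^sup>m\<close>, in Sturm--Liouville form.\<close>

lemma legendre_ode:
  "(1 - t\<^sup>2) * legendre_deriv l (m + 2) t =
     2 * (real m + 1) * t * legendre_deriv l (m + 1) t
     - (real l - real m) * (real l + real m + 1) * legendre_deriv l m t"
proof -
  define W where "W k = poly ((pderiv ^^ (l + k)) ([:-1, 0, 1:] ^ l)) t" for k
  have D: "legendre_deriv l k t = W k / (2 ^ l * fact l)" for k
    by (simp add: legendre_deriv_def higher_pderiv_legendre_poly W_def)
  have "(t\<^sup>2 - 1) * W (m + 2) = - 2 * (real m + 1) * t * W (m + 1)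
      + (real l + real m + 1) * (real l - real m) * W m"
    using arg_cong[OF rodrigues_ode[of "l + m" l], of "\<lambda>p. poly p t"]
    unfolding W_def by (simp add: power2_eq_square algebra_simps)
  then have "(1 - t\<^sup>2) * W (m + 2) = 2 * (real m + 1) * t * W (m + 1)
      - (real l - real m) * (real l + real m + 1) * W m" by (simp add: algebra_simps)
  then have "((1 - t\<^sup>2) * W (m + 2)) / (2 ^ l * fact l) = (2 * (real m + 1) * t * W (m + 1)
      - (real l - real m) * (real l + real m + 1) * W m) / (2 ^ l * fact l)" by simp
  then show ?thesis unfolding D by (simp only: diff_divide_distrib times_divide_eq_right)
qed

lemma degree_higher_pderiv_real: "degree ((pderiv ^^ k) (p :: real poly)) = degree p - k"
  by (induction k) (auto simp: degree_pderiv)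

lemma legendre_deriv_eq_0: "l < m \<Longrightarrow> legendre_deriv l m t = 0"
proof -
  assume "l < m"
  have "degree ([:-1, 0, 1 :: real:] ^ l) = 2 * l" by (simp add: degree_power_eq)
  then have "degree ((pderiv ^^ (l + (m - 1))) ([:-1, 0, 1 :: real:] ^ l)) = 0"
    using \<open>l < m\<close> by (simp add: degree_higher_pderiv_real)
  then have "(pderiv ^^ Suc (l + (m - 1))) ([:-1, 0, 1 :: real:] ^ l) = 0"
    by (simp add: pderiv_eq_0_iff)
  moreover have "Suc (l + (m - 1)) = l + m" using \<open>l < m\<close> by simp
  ultimately have "(pderiv ^^ (l + m)) ([:-1, 0, 1 :: real:] ^ l) = 0" by argo
  then show ?thesis by (simp add: legendre_deriv_def higher_pderiv_legendre_poly)
qed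

lemma higher_pderiv_pcompose_shift:
  "(pderiv ^^ k) (pcompose p [:a, 1:]) = pcompose ((pderiv ^^ k) p) [:a, 1 :: real:]"
  by (induction k) (auto simp: pderiv_pcompose pderiv_pCons)

lemma pcompose_power: "pcompose (p ^ n) q = pcompose p q ^ n"
  by (induction n) (simp_all add: pcompose_1 pcompose_mult)

text \<open>After the shift \<open>t = 1 + s\<close> Rodrigues' formula differentiates \<open>s\<^sup>l (s + 2)\<^sup>l\<close> exactly
  \<open>l\<close> times at \<open>s = 0\<close>, which reads off the coefficient \<open>2\<^sup>l\<close> of \<open>s\<^sup>l\<close>.\<close>

lemma legendre_poly_1: "legendre_deriv l 0 1 = 1"
proof -
  define q where "q = [:-1, 0, 1 :: real:] ^ l"
  have "pcompose q [:1, 1:] = [:0, 1:] ^ l * [:2, 1:] ^ l"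
    unfolding q_def pcompose_power power_mult_distrib[symmetric]
    by (simp add: pcompose_pCons)
  also have "\<dots> = monom 1 l * [:2, 1:] ^ l" by (simp add: monom_altdef)
  finally have "coeff (pcompose q [:1, 1:]) l = 2 ^ l"
    by (simp add: coeff_monom_mult coeff_0_power)
  moreover have "poly ((pderiv ^^ l) q) 1 = poly (pcompose ((pderiv ^^ l) q) [:1, 1:]) 0"
    by (simp add: poly_pcompose)
  ultimately have "poly ((pderiv ^^ l) q) 1 = fact l * 2 ^ l"
    by (simp add: higher_pderiv_pcompose_shift[symmetric] poly_0_coeff_0 coeff_higher_pderiv
        pochhammer_fact)
  then show ?thesis by (simp add: legendre_deriv_def legendre_poly_def q_def)
qed

definition factorial_ratio :: "nat \<Rightarrow> nat \<Rightarrow> real" where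
  "factorial_ratio l m = fact (l - m) / fact (l + m)"

lemma factorial_ratio_pos: "factorial_ratio l m > 0" by (simp add: factorial_ratio_def)

lemma factorial_ratio_Suc:
  assumes "m < l"
  shows "factorial_ratio l (Suc m) * ((real l - real m) * (real l + real m + 1)) = factorial_ratio l m"
proof -
  obtain k where l: "l = m + Suc k" using assms less_imp_Suc_add by force
  have "(fact (l + Suc m) :: real) = (real l + real m + 1) * fact (l + m)" by simp
  moreover have "(fact (l - m) :: real) = (real l - real m) * fact (l - Suc m)"
    by (simp add: l)
  ultimately show ?thesis by (simp only: factorial_ratio_def) simp
qed

text \<open>Unsoeld's identity. Let \<open>A\<^sub>m\<close> be \<open>(l - m)!/(l + m)! (1 - t\<^sup>2)\<^sup>m D\<^sup>m P\<^sub>l D\<^sup>m\<^sup>+\<^sup>1 P\<^sub>l\<close>. By the differential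
  equation the derivative of the \<open>m\<close>-th summand is \<open>A\<^sub>m - A\<^sub>m\<^sub>-\<^sub>1\<close>, so the derivative of the sum telescopes
  to \<open>A\<^sub>l - A\<^sub>0\<close>; here \<open>A\<^sub>l = 0\<close>, and \<open>2 A\<^sub>0\<close> is the derivative of \<open>P\<^sub>l\<^sup>2\<close>. The left-hand side
  is therefore constant, and at \<open>t = 1\<close> only \<open>P\<^sub>l(1)\<^sup>2 = 1\<close> survives.\<close>

lemma legendre_unsoeld:
  "(legendre_deriv l 0 t)\<^sup>2
     + 2 * (\<Sum>m=1..l. factorial_ratio l m * ((1 - t\<^sup>2) ^ m * (legendre_deriv l m t)\<^sup>2)) = 1"
    (is "?F t = 1")
proof -
  define A where "A t m = factorial_ratio l m * ((1 - t\<^sup>2) ^ m * legendre_deriv l m t * legendre_deriv l (Suc m) t)"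
    for t m
  have term_deriv: "((\<lambda>t. factorial_ratio l (Suc m) * ((1 - t\<^sup>2) ^ Suc m * (legendre_deriv l (Suc m) t)\<^sup>2))
      has_real_derivative A t (Suc m) - A t m) (at t)" if "m < l" for m t
  proof -
    let ?D = "legendre_deriv l"
    have ode: "2 * (real m + 1) * t * ?D (Suc m) t = (1 - t\<^sup>2) * ?D (Suc (Suc m)) t
        + (real l - real m) * (real l + real m + 1) * ?D m t"
      using legendre_ode[of t l m] by (simp add: numeral_2_eq_2)
    have "((\<lambda>t. factorial_ratio l (Suc m) * ((1 - t\<^sup>2) ^ Suc m * (?D (Suc m) t)\<^sup>2)) has_real_derivative
       factorial_ratio l (Suc m) * ((1 - t\<^sup>2) ^ m * ?D (Suc m) t *
         (2 * (1 - t\<^sup>2) * ?D (Suc (Suc m)) t - 2 * (real m + 1) * t * ?D (Suc m) t))) (at t)"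
      by (rule derivative_eq_intros refl)+ (simp add: algebra_simps power2_eq_square)
    also have "factorial_ratio l (Suc m) * ((1 - t\<^sup>2) ^ m * ?D (Suc m) t *
         (2 * (1 - t\<^sup>2) * ?D (Suc (Suc m)) t - 2 * (real m + 1) * t * ?D (Suc m) t))
      = A t (Suc m) - factorial_ratio l (Suc m) * ((real l - real m) * (real l + real m + 1))
           * ((1 - t\<^sup>2) ^ m * ?D m t * ?D (Suc m) t)"
      unfolding ode A_def by (simp add: algebra_simps)
    also have "\<dots> = A t (Suc m) - A t m" unfolding factorial_ratio_Suc[OF that] A_def ..
    finally show ?thesis .
  qed
  have "(?F has_real_derivative 0) (at t)" for t
  proof -
    have eq: "?F = (\<lambda>t. (legendre_deriv l 0 t)\<^sup>2
     + 2 * (\<Sum>m<l. factorial_ratio l (Suc m) * ((1 - t\<^sup>2) ^ Suc m * (legendre_deriv l (Suc m) t)\<^sup>2)))"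
      by (simp add: sum.atLeast1_atMost_eq)
    have "(?F has_real_derivative (2 * legendre_deriv l 0 t * legendre_deriv l (Suc 0) t
       + 2 * (\<Sum>m<l. A t (Suc m) - A t m))) (at t)"
      unfolding eq by (rule derivative_eq_intros DERIV_sum term_deriv refl | simp)+
    also have "(\<Sum>m<l. A t (Suc m) - A t m) = A t l - A t 0" by (rule sum_lessThan_telescope)
    also have "2 * legendre_deriv l 0 t * legendre_deriv l (Suc 0) t + 2 * (A t l - A t 0) = 0"
      by (simp add: A_def legendre_deriv_eq_0 factorial_ratio_def)
    finally show ?thesis .
  qed
  then have "?F t = ?F 1" by (rule DERIV_isconst_all[rule_format])
  also have "\<dots> = 1" by (auto simp: legendre_poly_1 intro!: sum.neutral)
  finally show ?thesis .
qed

definition legendre_inner :: "nat \<Rightarrow> nat \<Rightarrow> nat \<Rightarrow> real" where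
  "legendre_inner m l l' =
     integral {-1..1} (\<lambda>t. (1 - t\<^sup>2) ^ m * legendre_deriv l m t * legendre_deriv l' m t)"

lemma legendre_inner_commute: "legendre_inner m l l' = legendre_inner m l' l"
  unfolding legendre_inner_def by (intro integral_cong) simp

text \<open>Integration by parts against the Sturm--Liouville form of the differential equation; the factor
  \<open>1 - t\<^sup>2\<close> removes the boundary terms.\<close>

lemma legendre_inner_Suc:
  "legendre_inner (Suc m) l l' = (real l - real m) * (real l + real m + 1) * legendre_inner m l l'"
proof -
  let ?D = "legendre_deriv"
  let ?F = "\<lambda>t. (1 - t\<^sup>2) ^ Suc m * ?D l (Suc m) t * ?D l' m t"
  let ?c = "(real l - real m) * (real l + real m + 1)"
  have "(?F has_real_derivative
      (1 - t\<^sup>2) ^ Suc m * ?D l (Suc m) t * ?D l' (Suc m) t - ?c * ((1 - t\<^sup>2) ^ m * ?D l m t * ?D l' m t))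
      (at t within {-1..1})" for t
  proof -
    have "(?F has_real_derivative
        (1 - t\<^sup>2) ^ Suc m * ?D l (Suc m) t * ?D l' (Suc m) t
        + (1 - t\<^sup>2) ^ m * ?D l' m t * ((1 - t\<^sup>2) * ?D l (Suc (Suc m)) t
           - 2 * (real m + 1) * t * ?D l (Suc m) t)) (at t within {-1..1})"
      by (rule derivative_eq_intros refl)+ (simp add: algebra_simps power2_eq_square)
    also have "(1 - t\<^sup>2) * ?D l (Suc (Suc m)) t - 2 * (real m + 1) * t * ?D l (Suc m) t
        = - ?c * ?D l m t"
      using legendre_ode[of t l m] by (simp add: numeral_2_eq_2)
    finally show ?thesis by (simp only: minus_mult_left[symmetric] mult_minus_right mult.assoc mult.left_commute mult.commute diff_conv_add_uminus)
  qed
  then have "((\<lambda>t. (1 - t\<^sup>2) ^ Suc m * ?D l (Suc m) t * ?D l' (Suc m) t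
      - ?c * ((1 - t\<^sup>2) ^ m * ?D l m t * ?D l' m t)) has_integral (?F 1 - ?F (-1))) {-1..1}"
    by (intro fundamental_theorem_of_calculus)
       (simp_all flip: has_real_derivative_iff_has_vector_derivative)
  then have "integral {-1..1} (\<lambda>t. (1 - t\<^sup>2) ^ Suc m * ?D l (Suc m) t * ?D l' (Suc m) t
      - ?c * ((1 - t\<^sup>2) ^ m * ?D l m t * ?D l' m t)) = 0"
    by (intro integral_unique) simp
  then have "legendre_inner (Suc m) l l' - ?c * legendre_inner m l l' = 0"
    unfolding legendre_inner_def
    by (subst (asm) integral_diff) (auto intro!: integrable_continuous_real continuous_intros)
  then show ?thesis by simp
qed

text \<open>The recurrence can be read with either index as the distinguished one, and the two factors
  \<open>(l - m)(l + m + 1)\<close> and \<open>(l' - m)(l' + m + 1)\<close> differ for \<open>l \<noteq> l'\<close>.\<close>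

lemma legendre_inner_distinct:
  assumes "l \<noteq> l'"
  shows "legendre_inner m l l' = 0"
proof -
  have "(real l - real m) * (real l + real m + 1) * legendre_inner m l l'
      = (real l' - real m) * (real l' + real m + 1) * legendre_inner m l l'"
    using legendre_inner_Suc[of m l l'] legendre_inner_Suc[of m l' l]
    by (simp add: legendre_inner_commute)
  then have "(real l - real l') * (real l + real l' + 1) * legendre_inner m l l' = 0"
    by (simp add: algebra_simps)
  then show ?thesis using assms by auto
qed

lemma factorial_ratio_legendre_inner: "m \<le> l \<Longrightarrow> factorial_ratio l m * legendre_inner m l l = legendre_inner 0 l l"
proof (induction m)
  case (Suc m)
  then show ?case
    using factorial_ratio_Suc[of m l] by (metis Suc_leD Suc_le_lessD legendre_inner_Suc mult.assoc)
qed (simp add: factorial_ratio_def)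

text \<open>All the integrals on the left are equal by the recurrence in \<open>m\<close>, and integrating Unsoeld's
  identity over \<open>[-1, 1]\<close> says that \<open>2 l + 1\<close> copies of them add up to \<open>2\<close>.\<close>

lemma legendre_inner_same:
  assumes "m \<le> l"
  shows "factorial_ratio l m * legendre_inner m l l = 2 / (2 * real l + 1)"
proof -
  let ?D = "legendre_deriv l"
  have "integral {-1..1} (\<lambda>t. (1 - t\<^sup>2) ^ 0 * ?D 0 t * ?D 0 t
      + 2 * (\<Sum>m=1..l. factorial_ratio l m * ((1 - t\<^sup>2) ^ m * ?D m t * ?D m t))) = integral {-1..1::real} (\<lambda>t. 1)"
    using legendre_unsoeld[of l] by (intro integral_cong) (simp add: power2_eq_square mult.assoc)
  moreover have "((\<lambda>t. (1 - t\<^sup>2) ^ m * ?D m t * ?D m t) has_integral legendre_inner m l l) {-1..1}" for m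
    unfolding legendre_inner_def
    by (intro integrable_integral integrable_continuous_real continuous_intros)
  then have "((\<lambda>t. (1 - t\<^sup>2) ^ 0 * ?D 0 t * ?D 0 t
      + 2 * (\<Sum>m=1..l. factorial_ratio l m * ((1 - t\<^sup>2) ^ m * ?D m t * ?D m t)))
      has_integral (legendre_inner 0 l l + 2 * (\<Sum>m=1..l. factorial_ratio l m * legendre_inner m l l))) {-1..1}"
    by (intro has_integral_add has_integral_mult_right has_integral_sum finite_atLeastAtMost)
  ultimately have "legendre_inner 0 l l + 2 * (\<Sum>m=1..l. factorial_ratio l m * legendre_inner m l l) = 2"
    by (simp add: integral_unique)
  moreover have "(\<Sum>m=1..l. factorial_ratio l m * legendre_inner m l l) = (\<Sum>m=1..l. legendre_inner 0 l l)"
    by (intro sum.cong refl factorial_ratio_legendre_inner) simp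
  ultimately have "legendre_inner 0 l l + 2 * (\<Sum>m=1..l. legendre_inner 0 l l) = 2" by argo
  then have "legendre_inner 0 l l * (2 * real l + 1) = 2" by (simp add: algebra_simps)
  then show ?thesis using assms
    by (simp add: factorial_ratio_legendre_inner eq_divide_eq)
qed

section \<open>Spherical harmonics on the sphere\<close>

text \<open>The real constant in front of \<open>D\<^sup>m P\<^sub>l (cos \<theta>) sin\<^sup>m \<theta> e\<^sup>i\<^sup>m\<^sup>\<phi>\<close>, for both signs of \<open>m\<close>: for
  negative \<open>m\<close> the Condon--Shortley phase cancels against the sign in the definition of the
  harmonics.\<close>

definition sph_coef :: "nat \<Rightarrow> int \<Rightarrow> real" where
  "sph_coef l m = (if 0 \<le> m then (-1) ^ nat m else 1)
     * sqrt ((2 * real l + 1) / (4 * pi) * factorial_ratio l (nat \<bar>m\<bar>))"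

lemma sph_coef_square: "(sph_coef l m)\<^sup>2 = (2 * real l + 1) / (4 * pi) * factorial_ratio l (nat \<bar>m\<bar>)"
  using factorial_ratio_pos[of l "nat \<bar>m\<bar>"] by (simp add: sph_coef_def power_mult_distrib flip: power_mult)

lemma norm_vec3: "(norm (x :: real^3))\<^sup>2 = (x $ 1)\<^sup>2 + (x $ 2)\<^sup>2 + (x $ 3)\<^sup>2"
  unfolding norm_vec_def L2_set_def by (simp add: sum_3)

text \<open>On the sphere \<open>sqrt (1 - x\<^sub>3\<^sup>2)\<close> is the modulus of \<open>x\<^sub>1 + \<i> x\<^sub>2\<close>, so the discontinuous argument
  function combines with it to a power of \<open>x\<^sub>1 + \<i> x\<^sub>2\<close>. Continuity is evident in this form.\<close>

lemma sph_harm_sphere: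
  assumes "x \<in> S2"
  shows "sph_harm l m x = of_real (sph_coef l m * legendre_deriv l (nat \<bar>m\<bar>) (x $ 3))
     * (if 0 \<le> m then Complex (x $ 1) (x $ 2) else cnj (Complex (x $ 1) (x $ 2))) ^ nat \<bar>m\<bar>"
proof -
  define z where "z = Complex (x $ 1) (x $ 2)"
  have r: "sqrt (1 - (x $ 3)\<^sup>2) = cmod z"
    using assms norm_vec3[of x] by (simp add: z_def cmod_def algebra_simps)
  have *: "of_real (cmod z ^ k) * cis (real k * Arg z) = z ^ k" for k
    using rcis_cmod_Arg[of z] DeMoivre2[of "cmod z" "Arg z" k] by (simp add: rcis_def)
  have Y: "sph_harm_nonneg l k x = of_real (sqrt ((2 * real l + 1) / (4 * pi) * factorial_ratio l k) * (-1) ^ k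
      * legendre_deriv l k (x $ 3)) * z ^ k" for k
    unfolding sph_harm_nonneg_def assoc_legendre_def r factorial_ratio_def legendre_deriv_def *[symmetric] z_def[symmetric]
    by (simp add: ac_simps)
  have "(-1) ^ k * cnj (sph_harm_nonneg l k x) = of_real (sqrt ((2 * real l + 1) / (4 * pi) * factorial_ratio l k)
      * legendre_deriv l k (x $ 3)) * cnj z ^ k" for k
  proof -
    have "(-1) ^ k * (-1) ^ k = (1 :: complex)" by (simp flip: power_mult_distrib)
    then show ?thesis unfolding Y by simp
  qed
  with Y show ?thesis
    unfolding sph_harm_def sph_coef_def z_def[symmetric] by (simp add: ac_simps)
qed

lemma continuous_on_sph_harm: "continuous_on S2 (sph_harm l m)"
proof (subst continuous_on_cong[OF refl sph_harm_sphere])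
  show "continuous_on S2 (\<lambda>x. of_real (sph_coef l m * legendre_deriv l (nat \<bar>m\<bar>) (x $ 3))
     * (if 0 \<le> m then Complex (x $ 1) (x $ 2) else cnj (Complex (x $ 1) (x $ 2))) ^ nat \<bar>m\<bar>)"
    by (cases "0 \<le> m") (auto simp: Complex_eq intro!: continuous_intros)
qed

lemma sum_symmetric_int_interval:
  "(\<Sum>m = - int l..int l. f m) = f 0 + (\<Sum>m=1..l. f (int m) + f (- int m))"
proof (induction l)
  case (Suc l)
  have "{- int (Suc l)..int (Suc l)} = insert (int (Suc l)) (insert (- int (Suc l)) {- int l..int l})"
    by auto
  then show ?case using Suc by (simp add: algebra_simps)
qed simp

lemma sum_cmod_sph_harm:
  assumes "x \<in> S2"
  shows "(\<Sum>m = - int l..int l. (cmod (sph_harm l m x))\<^sup>2) = (2 * real l + 1) / (4 * pi)"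
proof -
  have r: "(cmod (Complex (x $ 1) (x $ 2)))\<^sup>2 = 1 - (x $ 3)\<^sup>2"
    using assms norm_vec3[of x] by (simp add: cmod_def)
  have "(cmod (sph_harm l m x))\<^sup>2 = (2 * real l + 1) / (4 * pi)
      * (factorial_ratio l (nat \<bar>m\<bar>) * ((1 - (x $ 3)\<^sup>2) ^ nat \<bar>m\<bar> * (legendre_deriv l (nat \<bar>m\<bar>) (x $ 3))\<^sup>2))" for m
  proof -
    let ?z = "if 0 \<le> m then Complex (x $ 1) (x $ 2) else cnj (Complex (x $ 1) (x $ 2))"
    have "cmod ?z = cmod (Complex (x $ 1) (x $ 2))" by (simp only: complex_mod_cnj if_cancel split: if_split) simp
    then have "(cmod (?z ^ nat \<bar>m\<bar>))\<^sup>2 = (1 - (x $ 3)\<^sup>2) ^ nat \<bar>m\<bar>"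
      unfolding r[symmetric] by (simp only: norm_power power_mult[symmetric] mult.commute)
    moreover have "(cmod (complex_of_real (sph_coef l m * legendre_deriv l (nat \<bar>m\<bar>) (x $ 3))))\<^sup>2
        = (2 * real l + 1) / (4 * pi) * factorial_ratio l (nat \<bar>m\<bar>) * (legendre_deriv l (nat \<bar>m\<bar>) (x $ 3))\<^sup>2"
      by (simp only: norm_of_real power2_abs power_mult_distrib sph_coef_square)
    ultimately show ?thesis
      unfolding sph_harm_sphere[OF assms] by (simp only: norm_mult power_mult_distrib) simp
  qed
  then have "(\<Sum>m = - int l..int l. (cmod (sph_harm l m x))\<^sup>2) = (2 * real l + 1) / (4 * pi) *
     ((legendre_deriv l 0 (x $ 3))\<^sup>2 + 2 * (\<Sum>m=1..l. factorial_ratio l m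
        * ((1 - (x $ 3)\<^sup>2) ^ m * (legendre_deriv l m (x $ 3))\<^sup>2)))"
    unfolding sum_symmetric_int_interval
    by (simp add: sum_distrib_left distrib_left mult.left_commute[of _ 2] flip: mult_2)
       (simp add: factorial_ratio_def)
  then show ?thesis unfolding legendre_unsoeld by simp
qed

section \<open>Integration over the sphere\<close>

lemma sets_sphere_measure [measurable_cong, simp]: "sets sphere_measure = sets (restrict_space borel S2)"
  by (simp add: sphere_measure_def)

lemma space_sphere_measure [simp]: "space sphere_measure = S2"
  by (simp add: sphere_measure_def space_restrict_space)

lemma sphere_point_nth:
  "sphere_point (\<theta>, \<phi>) $ 1 = sin \<theta> * cos \<phi>"
  "sphere_point (\<theta>, \<phi>) $ 2 = sin \<theta> * sin \<phi>"
  "sphere_point (\<theta>, \<phi>) $ 3 = cos \<theta>"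
  by (simp_all add: sphere_point_def)

lemma sphere_point_in_S2: "sphere_point z \<in> S2"
proof (cases z)
  case (Pair \<theta> \<phi>)
  have "(norm (sphere_point z))\<^sup>2 = (sin \<theta>)\<^sup>2 * ((cos \<phi>)\<^sup>2 + (sin \<phi>)\<^sup>2) + (cos \<theta>)\<^sup>2"
    unfolding Pair norm_vec3 sphere_point_nth by (simp only: power_mult_distrib distrib_left)
  then have "(norm (sphere_point z))\<^sup>2 = 1" by simp
  then show ?thesis by (simp add: power2_eq_1_iff) (smt (verit) norm_ge_zero)
qed

lemma continuous_on_sphere_point: "continuous_on A sphere_point"
proof -
  have "sphere_point = (\<lambda>z. (sin (fst z) * cos (snd z)) *\<^sub>R axis 1 1
      + (sin (fst z) * sin (snd z)) *\<^sub>R axis 2 1 + cos (fst z) *\<^sub>R axis 3 1)"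
    by (auto simp: fun_eq_iff vec_eq_iff forall_3 sphere_point_nth axis_def)
  moreover have "continuous_on A \<dots>" by (intro continuous_intros)
  ultimately show ?thesis by (rule back_subst[where P = "continuous_on A", rotated, OF sym])
qed

lemma sphere_point_measurable [measurable]: "sphere_point \<in> borel \<rightarrow>\<^sub>M restrict_space borel S2"
  by (intro measurable_restrict_space2 borel_measurable_continuous_onI continuous_on_sphere_point)
     (use sphere_point_in_S2 in blast)

definition polar_weight :: "real \<times> real \<Rightarrow> real" where
  "polar_weight z = indicator ({0..pi} \<times> {0..2 * pi}) z * sin (fst z)"

lemma polar_weight_nonneg: "0 \<le> polar_weight z"
  by (auto simp: polar_weight_def indicator_def sin_ge_zero)

lemma polar_weight_measurable [measurable]: "polar_weight \<in> borel_measurable borel"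
proof -
  have "closed ({0..pi} \<times> {0..2 * pi})" by (intro closed_Times closed_atLeastAtMost)
  then have [measurable]: "{0..pi} \<times> {0..2 * pi} \<in> sets borel" by (rule borel_closed)
  have [measurable]: "(\<lambda>z::real \<times> real. sin (fst z)) \<in> borel_measurable borel"
    by (intro borel_measurable_continuous_onI continuous_intros)
  show ?thesis unfolding polar_weight_def[abs_def] by measurable
qed

lemma sphere_measure_altdef:
  "sphere_measure = distr (density lborel (\<lambda>z. ennreal (polar_weight z))) (restrict_space borel S2) sphere_point"
  unfolding sphere_measure_def polar_weight_def
  by (rule arg_cong[where f = "\<lambda>f. distr (density lborel f) (restrict_space borel S2) sphere_point"])
     (auto simp: fun_eq_iff indicator_def)

lemma integrable_polar_weight: "integrable lborel polar_weight"
proof -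
  have "integrable lborel (\<lambda>z :: real \<times> real. indicator ({0..pi} \<times> {0..2 * pi}) z *\<^sub>R sin (fst z))"
    by (intro borel_integrable_compact compact_Times compact_Icc continuous_intros)
  then show ?thesis by (simp add: polar_weight_def[abs_def])
qed

lemma finite_sphere_measure: "finite_measure sphere_measure"
proof
  have "emeasure sphere_measure (space sphere_measure)
      = emeasure (density lborel (\<lambda>z. ennreal (polar_weight z))) (sphere_point -` S2 \<inter> UNIV)"
    unfolding space_sphere_measure unfolding sphere_measure_altdef
    by (subst emeasure_distr) (auto simp: sets_restrict_space_iff)
  also have "sphere_point -` S2 \<inter> UNIV = UNIV" using sphere_point_in_S2 by blast
  also have "emeasure (density lborel (\<lambda>z. ennreal (polar_weight z))) UNIV
      = (\<integral>\<^sup>+z. ennreal (polar_weight z) \<partial>lborel)"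
    by (subst emeasure_density) auto
  also have "\<dots> < \<infinity>"
    using integrable_polar_weight polar_weight_nonneg by (auto simp: integrable_iff_bounded)
  finally show "emeasure sphere_measure (space sphere_measure) \<noteq> \<infinity>" by simp
qed

interpretation sphere: finite_measure sphere_measure by (rule finite_sphere_measure)

lemma integrable_sphere_continuous:
  fixes f :: "real^3 \<Rightarrow> 'b::{banach, second_countable_topology}"
  assumes "continuous_on S2 f"
  shows "integrable sphere_measure f"
proof -
  have "compact (f ` S2)" using assms by (intro compact_continuous_image) auto
  then obtain K where K: "\<And>x. x \<in> S2 \<Longrightarrow> norm (f x) \<le> K"
    using compact_imp_bounded bounded_iff by (metis imageI)
  show ?thesis
  proof (rule sphere.integrable_const_bound[of _ K])
    show "AE x in sphere_measure. norm (f x) \<le> K" using K by (intro AE_I2) auto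
    show "f \<in> borel_measurable sphere_measure"
      using borel_measurable_continuous_on_restrict[OF assms] by simp
  qed
qed

text \<open>In polar coordinates products of spherical harmonics separate into a function of \<open>\<theta>\<close> and a
  function of \<open>\<phi>\<close>, so their integrals over the sphere factor.\<close>

lemma integral_rectangle_product:
  fixes u v :: "real \<Rightarrow> complex"
  assumes u: "continuous_on {a..b} u" and v: "continuous_on {c..d} v"
  shows "(\<integral>z. indicator ({a..b} \<times> {c..d}) z *\<^sub>R (u (fst z) * v (snd z)) \<partial>lborel)
      = integral {a..b} u * integral {c..d} v"
proof -
  let ?f = "\<lambda>z. indicator ({a..b} \<times> {c..d}) z *\<^sub>R (u (fst z) * v (snd z))"
  have "integrable lborel ?f"
    by (intro borel_integrable_compact compact_Times compact_Icc continuous_intros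
          continuous_on_compose2[OF u] continuous_on_compose2[OF v]) auto
  then have int: "integrable (lborel \<Otimes>\<^sub>M lborel) ?f" by (simp only: lborel_prod)
  have split: "?f (x, y) = (indicator {a..b} x *\<^sub>R u x) * (indicator {c..d} y *\<^sub>R v y)" for x y
    by (auto simp: indicator_def)
  have 1: "(\<integral>x. indicator {a..b} x *\<^sub>R u x \<partial>lborel) = integral {a..b} u"
    using set_borel_integral_eq_integral(2)[OF borel_integrable_atLeastAtMost'[OF u]]
    by (simp add: set_lebesgue_integral_def)
  have 2: "(\<integral>x. indicator {c..d} x *\<^sub>R v x \<partial>lborel) = integral {c..d} v"
    using set_borel_integral_eq_integral(2)[OF borel_integrable_atLeastAtMost'[OF v]]
    by (simp add: set_lebesgue_integral_def)
  have "integral\<^sup>L lborel ?f = integral\<^sup>L (lborel \<Otimes>\<^sub>M lborel) ?f" by (simp only: lborel_prod)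
  also have "\<dots> = (\<integral>x. (\<integral>y. ?f (x, y) \<partial>lborel) \<partial>lborel)"
    by (rule lborel_pair.integral_fst'[OF int, symmetric])
  also have "\<dots> = (\<integral>x. (indicator {a..b} x *\<^sub>R u x) * integral {c..d} v \<partial>lborel)"
    unfolding split by (simp only: integral_mult_right_zero 2)
  also have "\<dots> = integral {a..b} u * integral {c..d} v"
    by (simp only: integral_mult_left_zero 1)
  finally show ?thesis .
qed

lemma sphere_integral_product:
  fixes u v :: "real \<Rightarrow> complex"
  assumes f: "continuous_on S2 f"
    and u: "continuous_on {0..pi} u" and v: "continuous_on {0..2 * pi} v"
    and eq: "\<And>\<theta> \<phi>. \<theta> \<in> {0..pi} \<Longrightarrow> \<phi> \<in> {0..2 * pi} \<Longrightarrow> f (sphere_point (\<theta>, \<phi>)) = u \<theta> * v \<phi>"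
  shows "(\<integral>x. f x \<partial>sphere_measure)
      = integral {0..pi} (\<lambda>\<theta>. of_real (sin \<theta>) * u \<theta>) * integral {0..2 * pi} v"
proof -
  have m [measurable]: "f \<in> borel_measurable (restrict_space borel S2)"
    using borel_measurable_continuous_on_restrict[OF f] .
  have "(\<integral>x. f x \<partial>sphere_measure)
      = (\<integral>z. f (sphere_point z) \<partial>density lborel (\<lambda>z. ennreal (polar_weight z)))"
    unfolding sphere_measure_altdef by (rule integral_distr) auto
  also have "\<dots> = (\<integral>z. polar_weight z *\<^sub>R f (sphere_point z) \<partial>lborel)"
    by (rule integral_density) (auto simp: polar_weight_nonneg)
  also have "\<dots> = (\<integral>z. indicator ({0..pi} \<times> {0..2 * pi}) z *\<^sub>R
      ((of_real (sin (fst z)) * u (fst z)) * v (snd z)) \<partial>lborel)"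
    by (intro Bochner_Integration.integral_cong refl)
       (auto simp: polar_weight_def indicator_def eq scaleR_conv_of_real)
  also have "\<dots> = integral {0..pi} (\<lambda>\<theta>. of_real (sin \<theta>) * u \<theta>) * integral {0..2 * pi} v"
    by (intro integral_rectangle_product continuous_intros u v)
  finally show ?thesis .
qed

lemma integral_cis:
  "integral {0..2 * pi} (\<lambda>\<phi>. cis (real_of_int k * \<phi>)) = (if k = 0 then 2 * pi else 0)"
proof (cases "k = 0")
  case False
  define F where "F = (\<lambda>\<phi>. cis (real_of_int k * \<phi>) / (\<i> * of_int k))"
  have "((\<lambda>\<phi>. cis (real_of_int k * \<phi>)) has_integral (F (2 * pi) - F 0)) {0..2 * pi}"
  proof (rule fundamental_theorem_of_calculus)
    fix t :: real
    have "((\<lambda>z. exp (\<i> * of_int k * z) / (\<i> * of_int k)) has_field_derivative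
        exp (\<i> * of_int k * of_real t)) (at (of_real t))"
      using False by (auto intro!: derivative_eq_intros)
    from has_vector_derivative_real_field[OF this]
    show "(F has_vector_derivative cis (real_of_int k * t)) (at t within {0..2 * pi})"
      by (simp add: F_def cis_conv_exp mult.assoc)
  qed simp
  moreover have "F (2 * pi) = F 0"
    unfolding F_def using cis_multiple_2pi[of "of_int k"] by (simp add: mult.commute)
  ultimately show ?thesis using False by (simp add: integral_unique)
qed (simp add: scaleR_conv_of_real)

lemma integral_sin_cos_substitution:
  assumes "continuous_on {-1..1} f"
  shows "integral {0..pi} (\<lambda>\<theta>. sin \<theta> * f (cos \<theta>)) = integral {-1..1} (f :: real \<Rightarrow> real)"
proof -
  have "((\<lambda>\<theta>. - sin \<theta> *\<^sub>R f (cos \<theta>)) has_integral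
      (integral {cos 0..cos pi} f - integral {cos pi..cos 0} f)) {0..pi}"
    by (rule has_integral_substitution_general[where c = "-1" and d = 1 and s = "{}"])
       (use assms in \<open>auto intro!: derivative_eq_intros continuous_intros\<close>)
  from has_integral_neg[OF this]
  have "((\<lambda>\<theta>. sin \<theta> * f (cos \<theta>)) has_integral integral {-1..1} f) {0..pi}" by simp
  then show ?thesis by (rule integral_unique)
qed

lemma sph_harm_sphere_point:
  "sph_harm l m (sphere_point (\<theta>, \<phi>)) = of_real (sph_coef l m * (sin \<theta> ^ nat \<bar>m\<bar> * legendre_deriv l (nat \<bar>m\<bar>) (cos \<theta>)))
     * cis (of_int m * \<phi>)"
proof -
  have z: "Complex (sin \<theta> * cos \<phi>) (sin \<theta> * sin \<phi>) = of_real (sin \<theta>) * cis \<phi>"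
    by (simp add: complex_eq_iff)
  have "cis \<phi> ^ nat m = cis (of_int m * \<phi>)" if "0 \<le> m"
  proof -
    have "cis \<phi> ^ nat m = cis (real (nat m) * \<phi>)" by (rule Complex.DeMoivre)
    also have "real (nat m) * \<phi> = of_int m * \<phi>" using that by simp
    finally show ?thesis .
  qed
  moreover have "cis (- \<phi>) ^ nat (- m) = cis (of_int m * \<phi>)" if "\<not> 0 \<le> m"
  proof -
    have "cis (- \<phi>) ^ nat (- m) = cis (real (nat (- m)) * (- \<phi>))" by (rule Complex.DeMoivre)
    also have "real (nat (- m)) * (- \<phi>) = of_int m * \<phi>" using that by simp
    finally show ?thesis .
  qed
  ultimately have "(if 0 \<le> m then of_real (sin \<theta>) * cis \<phi> else cnj (of_real (sin \<theta>) * cis \<phi>)) ^ nat \<bar>m\<bar>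
      = of_real (sin \<theta> ^ nat \<bar>m\<bar>) * cis (of_int m * \<phi>)"
    by (auto simp: power_mult_distrib cis_cnj)
  then show ?thesis
    unfolding sph_harm_sphere[OF sphere_point_in_S2] sphere_point_nth z by simp
qed

text \<open>The integral over \<open>\<phi>\<close> separates the orders \<open>m\<close>; for equal orders the substitution
  \<open>t = cos \<theta>\<close> reduces the integral over \<open>\<theta>\<close> to the weighted Legendre integrals.\<close>

lemma sph_harm_orthonormal:
  assumes "\<bar>m\<bar> \<le> int l" "\<bar>m'\<bar> \<le> int l'"
  shows "(\<integral>x. sph_harm l m x * cnj (sph_harm l' m' x) \<partial>sphere_measure)
      = (if l = l' \<and> m = m' then 1 else 0)"
proof -
  define R where "R l m \<theta> = sph_coef l m * (sin \<theta> ^ nat \<bar>m\<bar> * legendre_deriv l (nat \<bar>m\<bar>) (cos \<theta>))"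
    for l m \<theta>
  have "(\<integral>x. sph_harm l m x * cnj (sph_harm l' m' x) \<partial>sphere_measure)
      = integral {0..pi} (\<lambda>\<theta>. of_real (sin \<theta>) * complex_of_real (R l m \<theta> * R l' m' \<theta>))
        * integral {0..2 * pi} (\<lambda>\<phi>. cis (of_int (m - m') * \<phi>))"
  proof (rule sphere_integral_product)
    show "continuous_on S2 (\<lambda>x. sph_harm l m x * cnj (sph_harm l' m' x))"
      by (intro continuous_intros continuous_on_sph_harm)
    show "continuous_on {0..pi} (\<lambda>\<theta>. complex_of_real (R l m \<theta> * R l' m' \<theta>))"
      unfolding R_def by (intro continuous_intros)
    show "continuous_on {0..2 * pi} (\<lambda>\<phi>. cis (of_int (m - m') * \<phi>))"
      unfolding cis_conv_exp by (intro continuous_intros)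
    show "sph_harm l m (sphere_point (\<theta>, \<phi>)) * cnj (sph_harm l' m' (sphere_point (\<theta>, \<phi>)))
        = complex_of_real (R l m \<theta> * R l' m' \<theta>) * cis (of_int (m - m') * \<phi>)" for \<theta> \<phi>
      unfolding sph_harm_sphere_point R_def by (simp add: cis_cnj cis_mult algebra_simps)
  qed
  also have "\<dots> = (if l = l' \<and> m = m' then 1 else 0)"
  proof (cases "m = m'")
    case True
    define k where "k = nat \<bar>m\<bar>"
    let ?f = "\<lambda>t. (1 - t\<^sup>2) ^ k * legendre_deriv l k t * legendre_deriv l' k t"
    have "integral {0..pi} (\<lambda>\<theta>. of_real (sin \<theta>) * complex_of_real (R l m \<theta> * R l' m' \<theta>))
       = integral {0..pi} (\<lambda>\<theta>. complex_of_real (sph_coef l m * sph_coef l' m * (sin \<theta> * ?f (cos \<theta>))))"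
    proof (intro integral_cong)
      fix \<theta> :: real
      have "(1 - (cos \<theta>)\<^sup>2) ^ k = sin \<theta> ^ k * sin \<theta> ^ k"
        using sin_squared_eq[of \<theta>] by (metis power2_eq_square power_mult_distrib)
      then show "of_real (sin \<theta>) * complex_of_real (R l m \<theta> * R l' m' \<theta>)
         = complex_of_real (sph_coef l m * sph_coef l' m * (sin \<theta> * ?f (cos \<theta>)))"
        unfolding R_def True[symmetric] k_def[symmetric] by simp
    qed
    also have "\<dots> = complex_of_real (sph_coef l m * sph_coef l' m * legendre_inner k l l')"
    proof -
      have "integral {0..pi} (\<lambda>\<theta>. sin \<theta> * ?f (cos \<theta>)) = legendre_inner k l l'"
        unfolding legendre_inner_def
        by (rule integral_sin_cos_substitution) (intro continuous_intros)
      moreover have "(\<lambda>\<theta>. sin \<theta> * ?f (cos \<theta>)) integrable_on {0..pi}"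
        by (intro integrable_continuous_real continuous_intros)
      ultimately have "((\<lambda>\<theta>. sin \<theta> * ?f (cos \<theta>)) has_integral legendre_inner k l l') {0..pi}"
        by (simp only: has_integral_integrable_integral)
      then have "((\<lambda>\<theta>. sph_coef l m * sph_coef l' m * (sin \<theta> * ?f (cos \<theta>)))
          has_integral (sph_coef l m * sph_coef l' m * legendre_inner k l l')) {0..pi}"
        by (rule has_integral_mult_right)
      from integral_unique[OF has_integral_of_real[OF this]] show ?thesis .
    qed
    also have "sph_coef l m * sph_coef l' m * legendre_inner k l l'
        = (if l = l' then 1 / (2 * pi) else 0)"
    proof (cases "l = l'")
      case True
      have "sph_coef l m * sph_coef l m * legendre_inner k l l
          = (2 * real l + 1) / (4 * pi) * (factorial_ratio l k * legendre_inner k l l)"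
        using sph_coef_square[of l m] by (simp add: k_def power2_eq_square mult.assoc)
      also have "factorial_ratio l k * legendre_inner k l l = 2 / (2 * real l + 1)"
        using assms(1) by (intro legendre_inner_same) (simp add: k_def)
      also have "(2 * real l + 1) / (4 * pi) * (2 / (2 * real l + 1)) = 1 / (2 * pi)"
        by (simp add: divide_simps)
      finally show ?thesis using True by simp
    qed (simp add: legendre_inner_distinct)
    finally show ?thesis using True by (simp add: integral_cis scaleR_conv_of_real)
  qed (simp only: integral_cis, simp)
  finally show ?thesis .
qed

section \<open>Zonal kernels\<close>

text \<open>The reproducing kernel of degree \<open>l\<close>, which the addition theorem identifies with
  \<open>(2 l + 1) / (4 \<pi>) P\<^sub>l (x \<bullet> y)\<close>. Taking the real part only changes the type.\<close>

definition zonal :: "nat \<Rightarrow> real^3 \<Rightarrow> real^3 \<Rightarrow> real" where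
  "zonal l x y = Re (\<Sum>m = - int l..int l. sph_harm l m x * cnj (sph_harm l m y))"

lemma sph_harm_uminus: "sph_harm l (- m) x = (-1) ^ nat \<bar>m\<bar> * cnj (sph_harm l m x)"
proof -
  have sign: "(-1) ^ k * ((-1) ^ k * z) = (z :: complex)" for k z
    by (simp flip: mult.assoc power_mult_distrib)
  consider "m > 0" | "m = 0" | "m < 0" by linarith
  then show ?thesis
    by cases (auto simp: sph_harm_def sph_harm_nonneg_def sign)
qed

text \<open>Conjugation exchanges the orders \<open>m\<close> and \<open>-m\<close> up to signs that cancel, so the sum is real.\<close>

lemma sum_sph_harm_eq_zonal:
  "(\<Sum>m = - int l..int l. sph_harm l m x * cnj (sph_harm l m y)) = of_real (zonal l x y)"
proof -
  let ?S = "\<Sum>m = - int l..int l. sph_harm l m x * cnj (sph_harm l m y)"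
  have sign: "(-1) ^ k * z * ((-1) ^ k * z') = (z * z' :: complex)" for k z z'
  proof -
    have "(-1) ^ k * (-1) ^ k = (1 :: complex)" by (simp flip: power_mult_distrib)
    then show ?thesis by (simp add: algebra_simps)
  qed
  have "cnj ?S = (\<Sum>m = - int l..int l. sph_harm l (- m) x * cnj (sph_harm l (- m) y))"
    by (simp add: sph_harm_uminus sign)
  also have "\<dots> = ?S"
    by (rule sum.reindex_bij_witness[of _ uminus uminus]) auto
  finally have "?S \<in> \<real>" by (rule Reals_cnj_iff[THEN iffD2])
  then show ?thesis unfolding zonal_def by (rule of_real_Re[symmetric])
qed

lemma zonal_commute: "zonal l x y = zonal l y x"
proof -
  have "zonal l x y = Re (cnj (\<Sum>m = - int l..int l. sph_harm l m x * cnj (sph_harm l m y)))"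
    by (simp only: zonal_def cnj.sel(1))
  also have "\<dots> = zonal l y x" by (simp add: zonal_def mult.commute)
  finally show ?thesis .
qed

lemma zonal_self: "x \<in> S2 \<Longrightarrow> zonal l x x = (2 * real l + 1) / (4 * pi)"
  unfolding zonal_def complex_norm_square[symmetric]
  by (simp add: sum_cmod_sph_harm del: mem_sphere_0)

lemma abs_zonal_le:
  assumes "x \<in> S2" "y \<in> S2"
  shows "\<bar>zonal l x y\<bar> \<le> (2 * real l + 1) / (4 * pi)"
proof -
  have "\<bar>zonal l x y\<bar> \<le> (\<Sum>m = - int l..int l. cmod (sph_harm l m x) * cmod (sph_harm l m y))"
    unfolding zonal_def by (intro order_trans[OF abs_Re_le_cmod] sum_norm_le) (simp add: norm_mult)
  also have "\<dots> \<le> (\<Sum>m = - int l..int l. ((cmod (sph_harm l m x))\<^sup>2 + (cmod (sph_harm l m y))\<^sup>2) / 2)"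
  proof (intro sum_mono)
    show "cmod (sph_harm l m x) * cmod (sph_harm l m y)
        \<le> ((cmod (sph_harm l m x))\<^sup>2 + (cmod (sph_harm l m y))\<^sup>2) / 2" for m
      using sum_squares_bound[of "cmod (sph_harm l m x)" "cmod (sph_harm l m y)"]
      by (simp add: mult.assoc)
  qed
  also have "\<dots> = (2 * real l + 1) / (4 * pi)"
    unfolding sum_divide_distrib[symmetric] sum.distrib sum_cmod_sph_harm[OF assms(1)]
      sum_cmod_sph_harm[OF assms(2)] by (simp only: mult_2[symmetric] nonzero_mult_div_cancel_left zero_neq_numeral[symmetric] not_False_eq_True)
  finally show ?thesis .
qed

lemma continuous_on_zonal:
  assumes "continuous_on A f" "continuous_on A g" "f ` A \<subseteq> S2" "g ` A \<subseteq> S2"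
  shows "continuous_on A (\<lambda>z. zonal l (f z) (g z))"
proof -
  have "continuous_on A (\<lambda>z. sph_harm l m (f z))" "continuous_on A (\<lambda>z. sph_harm l m (g z))" for m
    by (rule continuous_on_compose2[OF continuous_on_sph_harm], fact, fact)+
  then show ?thesis unfolding zonal_def by (intro continuous_intros)
qed

text \<open>The kernels of different degrees are the orthogonal projections onto mutually orthogonal spaces.\<close>

lemma zonal_reproducing:
  assumes "x \<in> S2" "z \<in> S2"
  shows "(\<integral>y. zonal l x y * zonal l' y z \<partial>sphere_measure) = (if l = l' then zonal l x z else 0)"
proof -
  let ?Y = sph_harm
  have int: "integrable sphere_measure (\<lambda>y. ?Y l' m' y * cnj (?Y l m y))" for m m'
    by (intro integrable_sphere_continuous continuous_intros continuous_on_sph_harm)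
  have "complex_of_real (\<integral>y. zonal l x y * zonal l' y z \<partial>sphere_measure)
      = (\<integral>y. of_real (zonal l x y * zonal l' y z) \<partial>sphere_measure)"
    by (rule integral_complex_of_real[symmetric])
  also have "\<dots> = (\<integral>y. (\<Sum>m = - int l..int l. \<Sum>m' = - int l'..int l'.
      (?Y l m x * cnj (?Y l' m' z)) * (?Y l' m' y * cnj (?Y l m y))) \<partial>sphere_measure)"
    by (simp add: sum_product algebra_simps flip: sum_sph_harm_eq_zonal)
  also have "\<dots> = (\<Sum>m = - int l..int l. \<Sum>m' = - int l'..int l'.
      (?Y l m x * cnj (?Y l' m' z)) * (\<integral>y. ?Y l' m' y * cnj (?Y l m y) \<partial>sphere_measure))"
    by (simp only: Bochner_Integration.integral_sum Bochner_Integration.integrable_sum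
        integrable_mult_right[OF int] integral_mult_right_zero)
  also have "\<dots> = (\<Sum>m = - int l..int l. \<Sum>m' = - int l'..int l'.
      (?Y l m x * cnj (?Y l' m' z)) * (if l' = l \<and> m' = m then 1 else 0))"
    by (intro sum.cong refl arg_cong2[where f = "(*)"] sph_harm_orthonormal) auto
  also have "\<dots> = (if l = l' then of_real (zonal l x z) else 0)"
    by (auto simp: if_distrib[where f = "(*) _"] sum.delta cong: if_cong simp flip: sum_sph_harm_eq_zonal)
  finally show ?thesis
    by (metis (mono_tags) of_real_0 of_real_eq_iff)
qed

definition zonal_series :: "(nat \<Rightarrow> real) \<Rightarrow> real^3 \<Rightarrow> real^3 \<Rightarrow> real" where
  "zonal_series k x y = (\<Sum>l. k l * zonal l x y)"

text \<open>The coefficients for which the bound \<open>\<bar>Z\<^sub>l\<bar> \<le> (2 l + 1) / (4 \<pi>)\<close> makes the series converge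
  uniformly.\<close>

definition zonal_summable :: "(nat \<Rightarrow> real) \<Rightarrow> bool" where
  "zonal_summable k \<longleftrightarrow> summable (\<lambda>l. \<bar>k l\<bar> * ((2 * real l + 1) / (4 * pi)))"

lemma abs_zonal_term_le:
  assumes "x \<in> S2" "y \<in> S2"
  shows "\<bar>k l * zonal l x y\<bar> \<le> \<bar>k l\<bar> * ((2 * real l + 1) / (4 * pi))"
  unfolding abs_mult by (intro mult_left_mono abs_zonal_le assms) simp

lemma summable_zonal:
  assumes "zonal_summable k" "x \<in> S2" "y \<in> S2"
  shows "summable (\<lambda>l. \<bar>k l * zonal l x y\<bar>)"
  by (rule summable_comparison_test'[OF assms(1)[unfolded zonal_summable_def]])
     (use abs_zonal_term_le[OF assms(2,3)] in simp)

lemma zonal_series_sums: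
  assumes "zonal_summable k" "x \<in> S2" "y \<in> S2"
  shows "(\<lambda>l. k l * zonal l x y) sums zonal_series k x y"
  unfolding zonal_series_def using summable_rabs_cancel[OF summable_zonal[OF assms]]
  by (rule summable_sums)

lemma zonal_series_commute: "zonal_series k x y = zonal_series k y x"
  by (simp add: zonal_series_def zonal_commute)

lemma continuous_on_zonal_series:
  assumes k: "zonal_summable k"
    and "continuous_on A f" "continuous_on A g" "f ` A \<subseteq> S2" "g ` A \<subseteq> S2"
  shows "continuous_on A (\<lambda>z. zonal_series k (f z) (g z))"
proof (rule uniform_limit_theorem)
  show "uniform_limit A (\<lambda>n z. \<Sum>l<n. k l * zonal l (f z) (g z))
      (\<lambda>z. zonal_series k (f z) (g z)) sequentially"
    unfolding zonal_series_def
  proof (rule Weierstrass_m_test)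
    show "norm (k l * zonal l (f z) (g z)) \<le> \<bar>k l\<bar> * ((2 * real l + 1) / (4 * pi))" if "z \<in> A" for l z
    proof -
      have "f z \<in> S2" "g z \<in> S2" using that assms(4,5) by blast+
      then show ?thesis using abs_zonal_term_le[of "f z" "g z" k l] by (simp only: real_norm_def)
    qed
  qed (use k in \<open>simp add: zonal_summable_def\<close>)
  show "\<forall>\<^sub>F n in sequentially. continuous_on A (\<lambda>z. \<Sum>l<n. k l * zonal l (f z) (g z))"
    by (intro always_eventually allI continuous_on_sum continuous_on_mult_left continuous_on_zonal[OF assms(2-5)])
qed simp

text \<open>Summability against the weights \<open>2 l + 1\<close> forces the coefficients to be bounded.\<close>

lemma zonal_summable_mult:
  assumes "zonal_summable k" "zonal_summable k'"
  shows "zonal_summable (\<lambda>l. k l * k' l)"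
proof -
  have "(\<lambda>l. \<bar>k' l\<bar> * ((2 * real l + 1) / (4 * pi))) \<longlonglongrightarrow> 0"
    using assms(2) unfolding zonal_summable_def by (rule summable_LIMSEQ_zero)
  then have "Bseq (\<lambda>l. \<bar>k' l\<bar> * ((2 * real l + 1) / (4 * pi)))"
    by (intro convergent_imp_Bseq convergentI)
  then obtain K where K: "\<And>l. \<bar>\<bar>k' l\<bar> * ((2 * real l + 1) / (4 * pi))\<bar> \<le> K"
    unfolding Bseq_def real_norm_def by blast
  have le: "\<bar>k' l\<bar> \<le> K * (4 * pi)" for l
  proof -
    have "\<bar>k' l\<bar> * ((2 * real l + 1) / (4 * pi)) \<le> K"
      by (rule order_trans[OF abs_ge_self K])
    then have "\<bar>k' l\<bar> * (2 * real l + 1) \<le> K * (4 * pi)"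
      by (simp only: times_divide_eq_right pos_divide_le_eq pi_gt_zero zero_less_mult_iff zero_less_numeral simp_thms)
    moreover have "\<bar>k' l\<bar> * 1 \<le> \<bar>k' l\<bar> * (2 * real l + 1)" by (rule mult_left_mono) simp_all
    ultimately show ?thesis by linarith
  qed
  have "summable (\<lambda>l. (K * (4 * pi)) * (\<bar>k l\<bar> * ((2 * real l + 1) / (4 * pi))))"
    using assms(1) unfolding zonal_summable_def by (rule summable_mult)
  then show ?thesis
    unfolding zonal_summable_def
  proof (rule summable_comparison_test')
    fix l :: nat
    have "\<bar>k l\<bar> * ((2 * real l + 1) / (4 * pi)) * \<bar>k' l\<bar> \<le> \<bar>k l\<bar> * ((2 * real l + 1) / (4 * pi)) * (K * (4 * pi))"
      by (intro mult_left_mono le) auto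
    then show "norm (\<bar>k l * k' l\<bar> * ((2 * real l + 1) / (4 * pi)))
        \<le> (K * (4 * pi)) * (\<bar>k l\<bar> * ((2 * real l + 1) / (4 * pi)))"
      by (simp add: abs_mult mult_ac)
  qed
qed

text \<open>Uniform convergence on a space of finite measure allows integration term by term.\<close>

lemma integral_mult_zonal_series_sums:
  assumes g: "continuous_on S2 g" and k: "zonal_summable k" and z: "z \<in> S2"
  shows "(\<lambda>l. k l * (\<integral>y. g y * zonal l y z \<partial>sphere_measure))
      sums (\<integral>y. g y * zonal_series k y z \<partial>sphere_measure)"
proof -
  let ?s = "\<lambda>l. \<bar>k l\<bar> * ((2 * real l + 1) / (4 * pi))"
  have "compact (g ` S2)" using g by (intro compact_continuous_image) auto
  then obtain K where K: "\<And>y. y \<in> S2 \<Longrightarrow> \<bar>g y\<bar> \<le> K"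
    using compact_imp_bounded bounded_iff by (metis imageI real_norm_def)
  have K0: "K \<ge> 0" using K[OF z] by linarith
  have bound: "\<bar>g y * (k l * zonal l y z)\<bar> \<le> K * ?s l" if "y \<in> S2" for y l
    unfolding abs_mult[of "g y"]
    by (intro mult_mono K abs_zonal_term_le that z K0) auto
  have sK: "summable (\<lambda>l. K * ?s l)"
    using k unfolding zonal_summable_def by (rule summable_mult)
  have cont: "continuous_on S2 (\<lambda>y. g y * (k l * zonal l y z))" for l
    by (intro continuous_intros g continuous_on_zonal) (use z in auto)
  have "(\<lambda>l. \<integral>y. g y * (k l * zonal l y z) \<partial>sphere_measure)
      sums (\<integral>y. (\<Sum>l. g y * (k l * zonal l y z)) \<partial>sphere_measure)"
  proof (rule sums_integral)
    show "integrable sphere_measure (\<lambda>y. g y * (k l * zonal l y z))" for l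
      by (intro integrable_sphere_continuous cont)
    show "AE y in sphere_measure. summable (\<lambda>l. norm (g y * (k l * zonal l y z)))"
      by (intro AE_I2 summable_comparison_test'[OF sK]) (use bound in auto)
    show "summable (\<lambda>l. \<integral>y. norm (g y * (k l * zonal l y z)) \<partial>sphere_measure)"
    proof (rule summable_comparison_test')
      show "summable (\<lambda>l. measure sphere_measure S2 * (K * ?s l))"
        using sK by (rule summable_mult)
      fix l :: nat
      have "(\<integral>y. norm (g y * (k l * zonal l y z)) \<partial>sphere_measure) \<le> (\<integral>y. K * ?s l \<partial>sphere_measure)"
        by (intro integral_mono integrable_norm integrable_sphere_continuous cont continuous_intros)
           (use bound in auto)
      then show "norm (\<integral>y. norm (g y * (k l * zonal l y z)) \<partial>sphere_measure)
          \<le> measure sphere_measure S2 * (K * ?s l)"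
        by simp
    qed
  qed
  also have "(\<integral>y. (\<Sum>l. g y * (k l * zonal l y z)) \<partial>sphere_measure)
      = (\<integral>y. g y * zonal_series k y z \<partial>sphere_measure)"
  proof (intro Bochner_Integration.integral_cong refl)
    fix y assume "y \<in> space sphere_measure"
    then have "(\<lambda>l. k l * zonal l y z) sums zonal_series k y z"
      using z by (intro zonal_series_sums k) auto
    from sums_unique[OF sums_mult[OF this, of "g y"]]
    show "(\<Sum>l. g y * (k l * zonal l y z)) = g y * zonal_series k y z" by simp
  qed
  finally show ?thesis by (simp only: mult.left_commute[of "g _"] integral_mult_right_zero)
qed

text \<open>Zonal kernels compose by multiplying coefficients: this turns both the covariance operator of the
  field and the needlet filter into multiplication by a sequence.\<close>

lemma zonal_series_convolution:
  assumes k: "zonal_summable k" and k': "zonal_summable k'" and x: "x \<in> S2" and z: "z \<in> S2"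
  shows "(\<integral>y. zonal_series k x y * zonal_series k' y z \<partial>sphere_measure)
      = zonal_series (\<lambda>l. k l * k' l) x z"
proof -
  have cont: "continuous_on S2 (\<lambda>y. zonal_series k x y)"
    by (intro continuous_on_zonal_series k continuous_intros) (use x in auto)
  \<comment> \<open>a single kernel picks out one coefficient of the other factor\<close>
  have single: "(\<integral>y. zonal_series k x y * zonal l y z \<partial>sphere_measure) = k l * zonal l x z" for l
  proof -
    have "(\<lambda>l'. k l' * (\<integral>y. zonal l z y * zonal l' y x \<partial>sphere_measure))
        sums (\<integral>y. zonal l z y * zonal_series k y x \<partial>sphere_measure)"
      by (intro integral_mult_zonal_series_sums k x continuous_on_zonal continuous_intros)
         (use z in auto)
    moreover have "(\<lambda>l'. k l' * (\<integral>y. zonal l z y * zonal l' y x \<partial>sphere_measure))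
        = (\<lambda>l'. if l' = l then k l * zonal l x z else 0)"
      by (auto simp: zonal_reproducing[OF z x] zonal_commute[of l z x])
    moreover have "(\<lambda>l'. if l' = l then k l * zonal l x z else 0) sums (k l * zonal l x z)"
      by (rule sums_single)
    ultimately have "(\<integral>y. zonal l z y * zonal_series k y x \<partial>sphere_measure) = k l * zonal l x z"
      using sums_unique2 by fastforce
    moreover have "zonal_series k x y * zonal l y z = zonal l z y * zonal_series k y x" for y
      by (simp add: zonal_commute[of l y z] zonal_series_commute[of k x y])
    ultimately show ?thesis by (simp add: zonal_commute[of l z x])
  qed
  have "(\<lambda>l. k' l * (k l * zonal l x z))
      sums (\<integral>y. zonal_series k x y * zonal_series k' y z \<partial>sphere_measure)"
    using integral_mult_zonal_series_sums[OF cont k' z] unfolding single .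
  moreover have "(\<lambda>l. k l * k' l * zonal l x z) sums zonal_series (\<lambda>l. k l * k' l) x z"
    by (intro zonal_series_sums zonal_summable_mult k k' x z)
  ultimately show ?thesis by (simp add: sums_unique2 mult_ac)
qed

section \<open>The covariance of the field\<close>

lemma borel_measurable_cnj [measurable]: "cnj \<in> borel_measurable borel"
  by (intro borel_measurable_continuous_onI continuous_intros)

lemma integrable_mult_of_square_integrable:
  fixes f g :: "'a \<Rightarrow> 'b::{banach, second_countable_topology, real_normed_algebra}"
  assumes [measurable]: "f \<in> borel_measurable M" "g \<in> borel_measurable M"
    and f: "integrable M (\<lambda>x. (norm (f x))\<^sup>2)" and g: "integrable M (\<lambda>x. (norm (g x))\<^sup>2)"
  shows "integrable M (\<lambda>x. f x * g x)"
proof (rule Bochner_Integration.integrable_bound)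
  show "integrable M (\<lambda>x. (norm (f x))\<^sup>2 + (norm (g x))\<^sup>2)"
    using f g by (rule Bochner_Integration.integrable_add)
  show "AE x in M. norm (f x * g x) \<le> norm ((norm (f x))\<^sup>2 + (norm (g x))\<^sup>2)"
  proof (rule AE_I2)
    fix x
    have "norm (f x * g x) \<le> norm (f x) * norm (g x)" by (rule norm_mult_ineq)
    also have "\<dots> \<le> 2 * norm (f x) * norm (g x)" by (simp add: mult.assoc)
    also have "\<dots> \<le> (norm (f x))\<^sup>2 + (norm (g x))\<^sup>2" by (rule sum_squares_bound)
    finally show "norm (f x * g x) \<le> norm ((norm (f x))\<^sup>2 + (norm (g x))\<^sup>2)" by simp
  qed
qed measurable

text \<open>The quadratic polynomial \<open>t \<mapsto> \<integral> (f - t g)\<^sup>2\<close> is nonnegative; it is evaluated at its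
  minimum, or far out when it degenerates to a linear function.\<close>

lemma Cauchy_Schwarz_integral:
  fixes f g :: "'a \<Rightarrow> real"
  assumes [measurable]: "f \<in> borel_measurable M" "g \<in> borel_measurable M"
    and f: "integrable M (\<lambda>x. (f x)\<^sup>2)" and g: "integrable M (\<lambda>x. (g x)\<^sup>2)"
  shows "(\<integral>x. f x * g x \<partial>M)\<^sup>2 \<le> (\<integral>x. (f x)\<^sup>2 \<partial>M) * (\<integral>x. (g x)\<^sup>2 \<partial>M)"
proof -
  define A where "A = (\<integral>x. (f x)\<^sup>2 \<partial>M)"
  define Q where "Q = (\<integral>x. f x * g x \<partial>M)"
  define G where "G = (\<integral>x. (g x)\<^sup>2 \<partial>M)"
  have fg: "integrable M (\<lambda>x. f x * g x)"
    by (rule integrable_mult_of_square_integrable) (use f g in simp_all)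
  have quad: "0 \<le> A - 2 * t * Q + t\<^sup>2 * G" for t
  proof -
    have "0 \<le> (\<integral>x. (f x - t * g x)\<^sup>2 \<partial>M)" by simp
    also have "\<dots> = (\<integral>x. (f x)\<^sup>2 - 2 * t * (f x * g x) + t\<^sup>2 * (g x)\<^sup>2 \<partial>M)"
      by (intro Bochner_Integration.integral_cong refl) (simp add: power2_eq_square algebra_simps)
    also have "\<dots> = A - 2 * t * Q + t\<^sup>2 * G"
      unfolding A_def Q_def G_def
      by (simp only: Bochner_Integration.integral_add Bochner_Integration.integral_diff
          Bochner_Integration.integrable_diff integrable_mult_right f g fg integral_mult_right_zero)
    finally show ?thesis .
  qed
  have G0: "0 \<le> G" by (simp add: G_def)
  have "Q\<^sup>2 \<le> A * G"
  proof (cases "G = 0")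
    case True
    have "Q = 0"
    proof (rule ccontr)
      assume "Q \<noteq> 0"
      \<comment> \<open>at this \<open>t\<close> the polynomial, now \<open>A - 2 t Q\<close>, takes the value \<open>-1\<close>\<close>
      then show False using quad[of "(A + 1) / (2 * Q)"] True by simp
    qed
    then show ?thesis using True by simp
  next
    case False
    then have "(Q / G)\<^sup>2 * G = Q\<^sup>2 / G" by (simp add: power2_eq_square)
    moreover have "2 * (Q / G) * Q = 2 * (Q\<^sup>2 / G)" by (simp add: power2_eq_square)
    ultimately have "A - 2 * (Q / G) * Q + (Q / G)\<^sup>2 * G = A - Q\<^sup>2 / G" by linarith
    with quad[of "Q / G"] have "Q\<^sup>2 / G \<le> A" by simp
    then show ?thesis using G0 False by (simp add: pos_divide_le_eq)
  qed
  then show ?thesis unfolding A_def Q_def G_def .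
qed

text \<open>Continuity of the inner product, for sequences that converge in mean square.\<close>

lemma integral_inner_tendsto_of_L2:
  fixes f g :: "'a \<Rightarrow> complex" and F G :: "nat \<Rightarrow> 'a \<Rightarrow> complex"
  assumes m [measurable]: "f \<in> borel_measurable M" "g \<in> borel_measurable M"
      "\<And>n. F n \<in> borel_measurable M" "\<And>n. G n \<in> borel_measurable M"
    and f: "integrable M (\<lambda>x. (cmod (f x))\<^sup>2)" and g: "integrable M (\<lambda>x. (cmod (g x))\<^sup>2)"
    and F: "\<And>n. integrable M (\<lambda>x. (cmod (F n x))\<^sup>2)" and G: "\<And>n. integrable M (\<lambda>x. (cmod (G n x))\<^sup>2)"
    and limF: "(\<lambda>n. \<integral>x. (cmod (f x - F n x))\<^sup>2 \<partial>M) \<longlonglongrightarrow> 0"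
    and limG: "(\<lambda>n. \<integral>x. (cmod (g x - G n x))\<^sup>2 \<partial>M) \<longlonglongrightarrow> 0"
  shows "(\<lambda>n. \<integral>x. F n x * cnj (G n x) \<partial>M) \<longlonglongrightarrow> (\<integral>x. f x * cnj (g x) \<partial>M)"
proof -
  define S where "S h = (\<integral>x. (cmod (h x))\<^sup>2 \<partial>M)" for h
  have prod: "integrable M (\<lambda>x. u x * cnj (v x))" "cmod (\<integral>x. u x * cnj (v x) \<partial>M) \<le> sqrt (S u) * sqrt (S v)"
    if [measurable]: "u \<in> borel_measurable M" "v \<in> borel_measurable M"
      and u: "integrable M (\<lambda>x. (cmod (u x))\<^sup>2)" and v: "integrable M (\<lambda>x. (cmod (v x))\<^sup>2)" for u v
  proof -
    show i: "integrable M (\<lambda>x. u x * cnj (v x))"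
      by (rule integrable_mult_of_square_integrable) (use u v in simp_all)
    have "cmod (\<integral>x. u x * cnj (v x) \<partial>M) \<le> (\<integral>x. cmod (u x * cnj (v x)) \<partial>M)"
      by (rule integral_norm_bound)
    also have "\<dots> = (\<integral>x. cmod (u x) * cmod (v x) \<partial>M)" by (simp add: norm_mult)
    also have "\<dots> \<le> sqrt (S u) * sqrt (S v)"
      unfolding S_def real_sqrt_mult[symmetric]
      by (rule real_le_rsqrt, rule Cauchy_Schwarz_integral) (use u v in simp_all)
    finally show "cmod (\<integral>x. u x * cnj (v x) \<partial>M) \<le> sqrt (S u) * sqrt (S v)" .
  qed
  have diff: "integrable M (\<lambda>x. (cmod (u x - v x))\<^sup>2)"
    if [measurable]: "u \<in> borel_measurable M" "v \<in> borel_measurable M"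
      and u: "integrable M (\<lambda>x. (cmod (u x))\<^sup>2)" and v: "integrable M (\<lambda>x. (cmod (v x))\<^sup>2)" for u v
  proof (rule Bochner_Integration.integrable_bound)
    show "integrable M (\<lambda>x. 2 * (cmod (u x))\<^sup>2 + 2 * (cmod (v x))\<^sup>2)" using u v by simp
    show "AE x in M. norm ((cmod (u x - v x))\<^sup>2) \<le> norm (2 * (cmod (u x))\<^sup>2 + 2 * (cmod (v x))\<^sup>2)"
    proof (rule AE_I2)
      fix x
      have "(cmod (u x - v x))\<^sup>2 \<le> (cmod (u x) + cmod (v x))\<^sup>2"
        by (intro power_mono norm_triangle_ineq4) simp
      also have "\<dots> \<le> 2 * (cmod (u x))\<^sup>2 + 2 * (cmod (v x))\<^sup>2"
        using sum_squares_bound[of "cmod (u x)" "cmod (v x)"] by (simp add: power2_sum)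
      finally show "norm ((cmod (u x - v x))\<^sup>2) \<le> norm (2 * (cmod (u x))\<^sup>2 + 2 * (cmod (v x))\<^sup>2)"
        by simp
    qed
  qed measurable
  let ?E = "\<lambda>n. (\<integral>x. F n x * cnj (G n x) \<partial>M)" and ?L = "\<integral>x. f x * cnj (g x) \<partial>M"
  let ?dF = "\<lambda>n x. f x - F n x" and ?dG = "\<lambda>n x. g x - G n x"
  have dF [measurable]: "?dF n \<in> borel_measurable M" "?dG n \<in> borel_measurable M" for n by measurable
  note iF = diff[OF m(1) m(3) f F] and iG = diff[OF m(2) m(4) g G]
  have bound: "norm (?E n - ?L) \<le> sqrt (S (?dF n)) * sqrt (S (?dG n)) + sqrt (S (?dF n)) * sqrt (S g)
      + sqrt (S f) * sqrt (S (?dG n))" for n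
  proof -
    have eq: "F n x * cnj (G n x) - f x * cnj (g x)
        = ?dF n x * cnj (?dG n x) - ?dF n x * cnj (g x) - f x * cnj (?dG n x)" for x
      by (simp add: algebra_simps)
    note i = prod(1)[OF dF iF iG, of n n] prod(1)[OF dF(1) m(2) iF g, of n] prod(1)[OF m(1) dF(2) f iG, of n]
    have "?E n - ?L = (\<integral>x. F n x * cnj (G n x) - f x * cnj (g x) \<partial>M)"
      by (rule Bochner_Integration.integral_diff[symmetric]) (rule prod(1)[OF m(3,4) F G], rule prod(1)[OF m(1,2) f g])
    also have "\<dots> = (\<integral>x. ?dF n x * cnj (?dG n x) - ?dF n x * cnj (g x) - f x * cnj (?dG n x) \<partial>M)"
      by (simp only: eq)
    also have "\<dots> = (\<integral>x. ?dF n x * cnj (?dG n x) \<partial>M) - (\<integral>x. ?dF n x * cnj (g x) \<partial>M)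
        - (\<integral>x. f x * cnj (?dG n x) \<partial>M)"
      by (simp only: Bochner_Integration.integral_diff Bochner_Integration.integrable_diff i)
    finally have "norm (?E n - ?L) = norm \<dots>" by (rule arg_cong)
    also have "\<dots> \<le> cmod (\<integral>x. ?dF n x * cnj (?dG n x) \<partial>M) + cmod (\<integral>x. ?dF n x * cnj (g x) \<partial>M)
        + cmod (\<integral>x. f x * cnj (?dG n x) \<partial>M)"
      by (rule order_trans[OF norm_triangle_ineq4 add_right_mono[OF norm_triangle_ineq4]])
    also have "\<dots> \<le> sqrt (S (?dF n)) * sqrt (S (?dG n)) + sqrt (S (?dF n)) * sqrt (S g)
      + sqrt (S f) * sqrt (S (?dG n))"
      by (rule add_mono[OF add_mono[OF prod(2)[OF dF iF iG] prod(2)[OF dF(1) m(2) iF g]] prod(2)[OF m(1) dF(2) f iG]])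
    finally show ?thesis .
  qed
  have sF: "(\<lambda>n. sqrt (S (?dF n))) \<longlonglongrightarrow> 0" and sG: "(\<lambda>n. sqrt (S (?dG n))) \<longlonglongrightarrow> 0"
    using tendsto_real_sqrt[OF limF] tendsto_real_sqrt[OF limG] by (simp_all add: S_def)
  have "(\<lambda>n. sqrt (S (?dF n)) * sqrt (S (?dG n)) + sqrt (S (?dF n)) * sqrt (S g)
      + sqrt (S f) * sqrt (S (?dG n))) \<longlonglongrightarrow> 0 * 0 + 0 * sqrt (S g) + sqrt (S f) * 0"
    by (intro tendsto_intros sF sG)
  then have lim0: "(\<lambda>n. sqrt (S (?dF n)) * sqrt (S (?dG n)) + sqrt (S (?dF n)) * sqrt (S g)
      + sqrt (S f) * sqrt (S (?dG n))) \<longlonglongrightarrow> 0" by simp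
  have "(\<lambda>n. ?E n - ?L) \<longlonglongrightarrow> 0"
    by (rule Lim_null_comparison[OF always_eventually[OF allI[OF bound]] lim0])
  then show ?thesis by (rule LIM_zero_cancel)
qed

context isotropic_field
begin

definition partial_field :: "nat \<Rightarrow> real^3 \<Rightarrow> 'w \<Rightarrow> complex" where
  "partial_field L x \<omega> = (\<Sum>l\<le>L. \<Sum>m = - int l..int l. a l m \<omega> * sph_harm l m x)"

lemma field_measurable [measurable]: "x \<in> S2 \<Longrightarrow> T x \<in> borel_measurable P"
  using measurable_compose[OF measurable_Pair1' measurable_field, of x] by simp

lemma coeff_inner:
  assumes "\<bar>m\<bar> \<le> int l" "\<bar>m'\<bar> \<le> int l'"
  shows "(\<integral>\<omega>. a l m \<omega> * cnj (a l' m' \<omega>) \<partial>P) = (if l = l' \<and> m = m' then of_real (C l) else 0)"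
proof (cases "l = l' \<and> m = m'")
  case True
  have "(\<integral>\<omega>. a l m \<omega> * cnj (a l m \<omega>) \<partial>P) = (\<integral>\<omega>. complex_of_real ((cmod (a l m \<omega>))\<^sup>2) \<partial>P)"
    by (simp only: complex_norm_square)
  also have "\<dots> = of_real (C l)"
    by (simp only: integral_complex_of_real angular_power_spectrum[OF assms(1)])
  finally show ?thesis using True by simp
qed (use coeff_orthogonal[OF assms] in auto)

lemma coeff_inner_integrable:
  assumes "\<bar>m\<bar> \<le> int l" "\<bar>m'\<bar> \<le> int l'"
  shows "integrable P (\<lambda>\<omega>. a l m \<omega> * cnj (a l' m' \<omega>))"
proof (rule integrable_mult_of_square_integrable)
  have [measurable]: "a l' m' \<in> borel_measurable P" using coeff_measurable[OF assms(2)] .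
  show "(\<lambda>\<omega>. cnj (a l' m' \<omega>)) \<in> borel_measurable P" by measurable
qed (use assms coeff_measurable coeff_square_integrable in auto)

lemma power_spectrum_nonneg: "0 \<le> C l"
  using angular_power_spectrum[of 0 l] by (metis abs_zero integral_nonneg_AE AE_I2 of_nat_0_le_iff zero_le_power2)

lemma partial_field_measurable: "partial_field L x \<in> borel_measurable P"
  unfolding partial_field_def[abs_def]
  by (intro borel_measurable_sum borel_measurable_times coeff_measurable borel_measurable_const) auto

text \<open>Orthogonality of the coefficients leaves only the diagonal of the double sum.\<close>

lemma partial_field_inner:
  shows "integrable P (\<lambda>\<omega>. partial_field L x \<omega> * cnj (partial_field L y \<omega>))" (is ?i)
    and "(\<integral>\<omega>. partial_field L x \<omega> * cnj (partial_field L y \<omega>) \<partial>P)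
      = of_real (\<Sum>l\<le>L. C l * zonal l x y)" (is ?e)
proof -
  let ?I = "Sigma {..L} (\<lambda>l. {- int l..int l})"
  let ?u = "\<lambda>i j \<omega>. (sph_harm (fst i) (snd i) x * cnj (sph_harm (fst j) (snd j) y))
        * (a (fst i) (snd i) \<omega> * cnj (a (fst j) (snd j) \<omega>))"
  have P: "partial_field L x \<omega> = (\<Sum>i\<in>?I. a (fst i) (snd i) \<omega> * sph_harm (fst i) (snd i) x)" for x \<omega>
    unfolding partial_field_def by (subst sum.Sigma) (auto simp: case_prod_beta)
  have eq: "partial_field L x \<omega> * cnj (partial_field L y \<omega>) = (\<Sum>i\<in>?I. \<Sum>j\<in>?I. ?u i j \<omega>)" for \<omega>
    unfolding P by (simp add: sum_product mult_ac)
  have int: "integrable P (?u i j)" if "i \<in> ?I" "j \<in> ?I" for i j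
    using that by (intro integrable_mult_right coeff_inner_integrable) auto
  show ?i unfolding eq by (intro Bochner_Integration.integrable_sum int)
  have "(\<integral>\<omega>. partial_field L x \<omega> * cnj (partial_field L y \<omega>) \<partial>P) = (\<Sum>i\<in>?I. \<integral>\<omega>. (\<Sum>j\<in>?I. ?u i j \<omega>) \<partial>P)"
    unfolding eq by (intro Bochner_Integration.integral_sum Bochner_Integration.integrable_sum int)
  also have "\<dots> = (\<Sum>i\<in>?I. \<Sum>j\<in>?I. \<integral>\<omega>. ?u i j \<omega> \<partial>P)"
    by (intro sum.cong refl Bochner_Integration.integral_sum int)
  also have "\<dots> = (\<Sum>i\<in>?I. \<Sum>j\<in>?I. if j = i then
      of_real (C (fst i)) * (sph_harm (fst i) (snd i) x * cnj (sph_harm (fst i) (snd i) y)) else 0)"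
  proof (intro sum.cong refl)
    fix i j assume "i \<in> ?I" "j \<in> ?I"
    then show "(\<integral>\<omega>. ?u i j \<omega> \<partial>P) = (if j = i then
      of_real (C (fst i)) * (sph_harm (fst i) (snd i) x * cnj (sph_harm (fst i) (snd i) y)) else 0)"
      by (auto simp: coeff_inner prod_eq_iff)
  qed
  also have "\<dots> = (\<Sum>i\<in>?I. of_real (C (fst i)) * (sph_harm (fst i) (snd i) x * cnj (sph_harm (fst i) (snd i) y)))"
    by (intro sum.cong refl) (simp add: sum.delta)
  also have "\<dots> = (\<Sum>l\<le>L. \<Sum>m = - int l..int l. of_real (C l) * (sph_harm l m x * cnj (sph_harm l m y)))"
    by (subst sum.Sigma) (auto simp: case_prod_beta)
  also have "\<dots> = of_real (\<Sum>l\<le>L. C l * zonal l x y)"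
    by (simp add: sum_sph_harm_eq_zonal flip: sum_distrib_left)
  finally show ?e .
qed

text \<open>The spectral representation holds in mean square, so the covariances of the partial sums converge
  to that of the field.\<close>

lemma covariance_sums:
  assumes x: "x \<in> S2" and y: "y \<in> S2"
  shows "(\<lambda>l. C l * zonal l x y) sums (\<integral>\<omega>. T x \<omega> * T y \<omega> \<partial>P)"
proof -
  have sq: "integrable P (\<lambda>\<omega>. (cmod (partial_field L z \<omega>))\<^sup>2)" for L z
    using integrable_Re[OF partial_field_inner(1)[of L z z]]
    by (simp add: complex_mult_cnj cmod_power2)
  have "(\<lambda>L. \<integral>\<omega>. partial_field L x \<omega> * cnj (partial_field L y \<omega>) \<partial>P)
      \<longlonglongrightarrow> (\<integral>\<omega>. complex_of_real (T x \<omega>) * cnj (complex_of_real (T y \<omega>)) \<partial>P)"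
  proof (rule integral_inner_tendsto_of_L2)
    show "(\<lambda>\<omega>. complex_of_real (T x \<omega>)) \<in> borel_measurable P"
      "(\<lambda>\<omega>. complex_of_real (T y \<omega>)) \<in> borel_measurable P"
      using field_measurable[OF x] field_measurable[OF y] by measurable
    show "integrable P (\<lambda>\<omega>. (cmod (complex_of_real (T x \<omega>)))\<^sup>2)"
      "integrable P (\<lambda>\<omega>. (cmod (complex_of_real (T y \<omega>)))\<^sup>2)"
      using finite_variance[OF x] finite_variance[OF y] by simp_all
    show "(\<lambda>L. \<integral>\<omega>. (cmod (complex_of_real (T x \<omega>) - partial_field L x \<omega>))\<^sup>2 \<partial>P) \<longlonglongrightarrow> 0"
      "(\<lambda>L. \<integral>\<omega>. (cmod (complex_of_real (T y \<omega>) - partial_field L y \<omega>))\<^sup>2 \<partial>P) \<longlonglongrightarrow> 0"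
      unfolding partial_field_def
      using spectral_representation[OF x] spectral_representation[OF y] by simp_all
  qed (intro partial_field_measurable sq)+
  also have "(\<integral>\<omega>. complex_of_real (T x \<omega>) * cnj (complex_of_real (T y \<omega>)) \<partial>P)
      = of_real (\<integral>\<omega>. T x \<omega> * T y \<omega> \<partial>P)"
    by (simp flip: of_real_mult)
  finally have "(\<lambda>L. \<Sum>l\<le>L. C l * zonal l x y) \<longlonglongrightarrow> (\<integral>\<omega>. T x \<omega> * T y \<omega> \<partial>P)"
    unfolding partial_field_inner(2) tendsto_of_real_iff .
  then show ?thesis by (simp add: sums_def_le)
qed

text \<open>The variance at a single point is already the series \<open>\<Sum>l. (2 l + 1) / (4 \<pi>) C\<^sub>l\<close>.\<close>

lemma zonal_summable_spectrum: "zonal_summable C"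
proof -
  note x = sphere_point_in_S2[of "(0, 0)"]
  show ?thesis
    using sums_summable[OF covariance_sums[OF x x]]
    unfolding zonal_summable_def zonal_self[OF x] abs_of_nonneg[OF power_spectrum_nonneg] by assumption
qed

lemma covariance_eq:
  assumes x: "x \<in> S2" and y: "y \<in> S2"
  shows "(\<integral>\<omega>. T x \<omega> * T y \<omega> \<partial>P) = zonal_series C x y"
  using sums_unique2[OF covariance_sums[OF x y] zonal_series_sums[OF zonal_summable_spectrum x y]] .

end

section \<open>Second moments of needlet coefficients\<close>

definition smear :: "(real^3 \<Rightarrow> 'w \<Rightarrow> real) \<Rightarrow> (real^3 \<Rightarrow> real) \<Rightarrow> 'w \<Rightarrow> real" where
  "smear T h \<omega> = (\<integral>x. T x \<omega> * h x \<partial>sphere_measure)"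

lemma continuous_on_S2_bounded:
  fixes h :: "real^3 \<Rightarrow> real"
  assumes "continuous_on S2 h"
  obtains K where "0 \<le> K" "\<And>x. x \<in> S2 \<Longrightarrow> \<bar>h x\<bar> \<le> K"
proof -
  have "compact (h ` S2)" using assms by (intro compact_continuous_image) auto
  then have "bounded (h ` S2)" by (rule compact_imp_bounded)
  then obtain K where K: "\<forall>y\<in>h ` S2. norm y \<le> K" unfolding bounded_iff by blast
  show ?thesis
    by (rule that[of "max K 0"]) (use K in \<open>auto simp: le_max_iff_disj simp del: mem_sphere_0\<close>)
qed

context isotropic_field
begin

lemma pair_sigma_finite_sphere: "pair_sigma_finite sphere_measure P"
  by (intro pair_sigma_finite.intro sphere.sigma_finite_measure_axioms sigma_finite_measure_axioms)

text \<open>The variance is continuous in the point and hence integrable over the sphere. This is the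
  domination behind all uses of Fubini's theorem for the field.\<close>

lemma field_square_integrable: "integrable (sphere_measure \<Otimes>\<^sub>M P) (\<lambda>(x, \<omega>). (T x \<omega>)\<^sup>2)"
proof -
  interpret SP: pair_sigma_finite sphere_measure P by (rule pair_sigma_finite_sphere)
  note [measurable] = measurable_field
  have eq: "(\<integral>\<omega>. (T x \<omega>)\<^sup>2 \<partial>P) = zonal_series C x x" if "x \<in> S2" for x
    using covariance_eq[OF that that] by (simp add: power2_eq_square)
  have cont: "integrable sphere_measure (\<lambda>x. zonal_series C x x)"
    by (intro integrable_sphere_continuous continuous_on_zonal_series zonal_summable_spectrum
        continuous_on_id) auto
  show ?thesis
  proof (rule SP.Fubini_integrable)
    have "(\<lambda>z. (case z of (x, \<omega>) \<Rightarrow> T x \<omega>)\<^sup>2) \<in> borel_measurable (sphere_measure \<Otimes>\<^sub>M P)" by measurable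
    then show "(\<lambda>(x, \<omega>). (T x \<omega>)\<^sup>2) \<in> borel_measurable (sphere_measure \<Otimes>\<^sub>M P)"
      by (simp add: case_prod_beta)
    show "integrable sphere_measure (\<lambda>x. \<integral>\<omega>. norm (case (x, \<omega>) of (x, \<omega>) \<Rightarrow> (T x \<omega>)\<^sup>2) \<partial>P)"
      by (subst Bochner_Integration.integrable_cong[OF refl, where g = "\<lambda>x. zonal_series C x x"])
         (use cont eq in \<open>simp_all del: mem_sphere_0\<close>)
    show "AE x in sphere_measure. integrable P (\<lambda>\<omega>. case (x, \<omega>) of (x, \<omega>) \<Rightarrow> (T x \<omega>)\<^sup>2)"
      by (rule AE_I2) (use finite_variance in \<open>simp del: mem_sphere_0\<close>)
  qed
qed

text \<open>Since \<open>h\<close> is bounded, \<open>T\<^sup>2 + Y\<^sup>2\<close> dominates the product up to a constant.\<close>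

lemma smear_integrand_integrable:
  assumes h: "continuous_on S2 h" and Y [measurable]: "Y \<in> borel_measurable P"
    and Y2: "integrable P (\<lambda>\<omega>. (Y \<omega>)\<^sup>2)"
  shows "integrable (sphere_measure \<Otimes>\<^sub>M P) (\<lambda>(x, \<omega>). T x \<omega> * h x * Y \<omega>)"
proof -
  interpret SP: pair_sigma_finite sphere_measure P by (rule pair_sigma_finite_sphere)
  note [measurable] = measurable_field
  obtain K where K: "0 \<le> K" "\<And>x. x \<in> S2 \<Longrightarrow> \<bar>h x\<bar> \<le> K"
    using continuous_on_S2_bounded[OF h] by blast
  have hm [measurable]: "h \<in> borel_measurable sphere_measure"
    using integrable_sphere_continuous[OF h] by (rule borel_measurable_integrable)
  have Y2': "integrable (sphere_measure \<Otimes>\<^sub>M P) (\<lambda>(x, \<omega>). (Y \<omega>)\<^sup>2)"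
    by (rule SP.Fubini_integrable) (use Y2 in simp_all)
  have 1: "(\<lambda>z. (case z of (x, \<omega>) \<Rightarrow> T x \<omega>) * h (fst z) * Y (snd z))
      \<in> borel_measurable (sphere_measure \<Otimes>\<^sub>M P)"
    by measurable
  show ?thesis
  proof (rule Bochner_Integration.integrable_bound)
    show "integrable (sphere_measure \<Otimes>\<^sub>M P) (\<lambda>z. K * ((case z of (x, \<omega>) \<Rightarrow> (T x \<omega>)\<^sup>2)
        + (case z of (x, \<omega>) \<Rightarrow> (Y \<omega>)\<^sup>2)))"
      by (intro integrable_mult_right Bochner_Integration.integrable_add field_square_integrable Y2')
    show "(\<lambda>(x, \<omega>). T x \<omega> * h x * Y \<omega>) \<in> borel_measurable (sphere_measure \<Otimes>\<^sub>M P)"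
      using 1 by (simp add: case_prod_beta)
    show "AE z in sphere_measure \<Otimes>\<^sub>M P. norm (case z of (x, \<omega>) \<Rightarrow> T x \<omega> * h x * Y \<omega>)
        \<le> norm (K * ((case z of (x, \<omega>) \<Rightarrow> (T x \<omega>)\<^sup>2) + (case z of (x, \<omega>) \<Rightarrow> (Y \<omega>)\<^sup>2)))"
    proof (rule AE_I2)
      fix z assume "z \<in> space (sphere_measure \<Otimes>\<^sub>M P)"
      then obtain x \<omega> where z: "z = (x, \<omega>)" and x: "x \<in> S2" by (auto simp: space_pair_measure)
      have "\<bar>T x \<omega>\<bar> * \<bar>Y \<omega>\<bar> \<le> 2 * \<bar>T x \<omega>\<bar> * \<bar>Y \<omega>\<bar>" by (simp add: mult.assoc)
      also have "\<dots> \<le> (T x \<omega>)\<^sup>2 + (Y \<omega>)\<^sup>2"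
        using sum_squares_bound[of "\<bar>T x \<omega>\<bar>" "\<bar>Y \<omega>\<bar>"] by (simp only: power2_abs)
      finally have "\<bar>h x\<bar> * (\<bar>T x \<omega>\<bar> * \<bar>Y \<omega>\<bar>) \<le> K * ((T x \<omega>)\<^sup>2 + (Y \<omega>)\<^sup>2)"
        by (intro mult_mono K x) simp_all
      also have "\<dots> \<le> norm (K * ((T x \<omega>)\<^sup>2 + (Y \<omega>)\<^sup>2))" by simp
      finally show "norm (case z of (x, \<omega>) \<Rightarrow> T x \<omega> * h x * Y \<omega>)
        \<le> norm (K * ((case z of (x, \<omega>) \<Rightarrow> (T x \<omega>)\<^sup>2) + (case z of (x, \<omega>) \<Rightarrow> (Y \<omega>)\<^sup>2)))"
        unfolding z by (simp only: split_conv abs_mult real_norm_def mult.assoc mult.left_commute)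
    qed
  qed
qed

lemma smear_measurable:
  assumes h: "continuous_on S2 h"
  shows "smear T h \<in> borel_measurable P"
proof -
  interpret SP: pair_sigma_finite sphere_measure P by (rule pair_sigma_finite_sphere)
  \<comment> \<open>the case \<open>Y = 1\<close> of the previous lemma\<close>
  have "integrable P (\<lambda>\<omega>. \<integral>x. T x \<omega> * h x * 1 \<partial>sphere_measure)"
    by (intro SP.integrable_snd smear_integrand_integrable h) simp_all
  then show ?thesis unfolding smear_def[abs_def] by simp
qed

text \<open>The Cauchy--Schwarz inequality in the space variable, for almost every \<open>\<omega>\<close>.\<close>

lemma smear_square_integrable:
  assumes h: "continuous_on S2 h"
  shows "integrable P (\<lambda>\<omega>. (smear T h \<omega>)\<^sup>2)"
proof -
  interpret SP: pair_sigma_finite sphere_measure P by (rule pair_sigma_finite_sphere)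
  note [measurable] = measurable_field
  have hm [measurable]: "h \<in> borel_measurable sphere_measure"
    using integrable_sphere_continuous[OF h] by (rule borel_measurable_integrable)
  have h2: "integrable sphere_measure (\<lambda>x. (h x)\<^sup>2)"
    by (intro integrable_sphere_continuous continuous_intros h)
  show ?thesis
  proof (rule Bochner_Integration.integrable_bound)
    show "integrable P (\<lambda>\<omega>. (\<integral>x. (T x \<omega>)\<^sup>2 \<partial>sphere_measure) * (\<integral>x. (h x)\<^sup>2 \<partial>sphere_measure))"
      by (intro integrable_mult_left SP.integrable_snd field_square_integrable)
    show "(\<lambda>\<omega>. (smear T h \<omega>)\<^sup>2) \<in> borel_measurable P"
      by (intro borel_measurable_power smear_measurable h)
    show "AE \<omega> in P. norm ((smear T h \<omega>)\<^sup>2)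
        \<le> norm ((\<integral>x. (T x \<omega>)\<^sup>2 \<partial>sphere_measure) * (\<integral>x. (h x)\<^sup>2 \<partial>sphere_measure))"
      using SP.AE_integrable_snd[OF field_square_integrable] AE_space
    proof eventually_elim
      case (elim \<omega>)
      have "(\<lambda>x. case (x, \<omega>) of (x, \<omega>) \<Rightarrow> T x \<omega>) \<in> borel_measurable sphere_measure"
        by (rule measurable_compose[OF measurable_Pair2' measurable_field]) (rule elim)
      then have "(\<lambda>x. T x \<omega>) \<in> borel_measurable sphere_measure" by simp
      from Cauchy_Schwarz_integral[OF this hm elim(1) h2]
      have "(smear T h \<omega>)\<^sup>2 \<le> (\<integral>x. (T x \<omega>)\<^sup>2 \<partial>sphere_measure) * (\<integral>x. (h x)\<^sup>2 \<partial>sphere_measure)"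
        unfolding smear_def .
      then show ?case unfolding real_norm_def abs_power2 by (rule order_trans[OF _ abs_ge_self])
    qed
  qed
qed

text \<open>Having a general square-integrable \<open>Y\<close> here allows the lemma to be applied twice in succession,
  once for each factor of a product of smeared fields; this replaces an exchange of integrals over the
  product of three spaces.\<close>

lemma expectation_smear_mult:
  assumes h: "continuous_on S2 h" and Y: "Y \<in> borel_measurable P"
    and Y2: "integrable P (\<lambda>\<omega>. (Y \<omega>)\<^sup>2)"
  shows "(\<integral>\<omega>. smear T h \<omega> * Y \<omega> \<partial>P) = (\<integral>x. h x * (\<integral>\<omega>. T x \<omega> * Y \<omega> \<partial>P) \<partial>sphere_measure)"
proof -
  interpret SP: pair_sigma_finite sphere_measure P by (rule pair_sigma_finite_sphere)
  have "(\<integral>\<omega>. smear T h \<omega> * Y \<omega> \<partial>P) = (\<integral>\<omega>. (\<integral>x. T x \<omega> * h x * Y \<omega> \<partial>sphere_measure) \<partial>P)"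
    unfolding smear_def by (simp only: integral_mult_left_zero)
  also have "\<dots> = (\<integral>x. (\<integral>\<omega>. T x \<omega> * h x * Y \<omega> \<partial>P) \<partial>sphere_measure)"
    by (rule SP.Fubini_integral[OF smear_integrand_integrable[OF h Y Y2]])
  also have "\<dots> = (\<integral>x. (\<integral>\<omega>. h x * (T x \<omega> * Y \<omega>) \<partial>P) \<partial>sphere_measure)"
    by (simp only: mult_ac)
  finally show ?thesis by (simp only: integral_mult_right_zero)
qed

text \<open>Both integrals against the covariance kernel are convolutions of zonal series.\<close>

lemma expectation_smear_zonal_series:
  assumes k: "zonal_summable k" "zonal_summable k'" and \<xi>: "\<xi> \<in> S2" "\<eta> \<in> S2"
  shows "(\<integral>\<omega>. smear T (zonal_series k \<xi>) \<omega> * smear T (zonal_series k' \<eta>) \<omega> \<partial>P)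
      = zonal_series (\<lambda>l. k l * k' l * C l) \<xi> \<eta>"
proof -
  have cont: "continuous_on S2 (zonal_series c z)" if "zonal_summable c" "z \<in> S2" for c z
    by (rule continuous_on_zonal_series[OF that(1) continuous_on_const continuous_on_id])
       (use that(2) in auto)
  note C = zonal_summable_spectrum
  have inner: "(\<integral>\<omega>. T x \<omega> * smear T (zonal_series k' \<eta>) \<omega> \<partial>P) = zonal_series (\<lambda>l. k' l * C l) \<eta> x"
    if x: "x \<in> S2" for x
  proof -
    have "(\<integral>\<omega>. T x \<omega> * smear T (zonal_series k' \<eta>) \<omega> \<partial>P)
        = (\<integral>\<omega>. smear T (zonal_series k' \<eta>) \<omega> * T x \<omega> \<partial>P)" by (simp only: mult.commute)
    also have "\<dots> = (\<integral>y. zonal_series k' \<eta> y * (\<integral>\<omega>. T y \<omega> * T x \<omega> \<partial>P) \<partial>sphere_measure)"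
      by (rule expectation_smear_mult[OF cont[OF k(2) \<xi>(2)] field_measurable[OF x] finite_variance[OF x]])
    also have "\<dots> = (\<integral>y. zonal_series k' \<eta> y * zonal_series C y x \<partial>sphere_measure)"
      by (intro Bochner_Integration.integral_cong refl) (use covariance_eq x in \<open>simp del: mem_sphere_0\<close>)
    also have "\<dots> = zonal_series (\<lambda>l. k' l * C l) \<eta> x"
      by (rule zonal_series_convolution[OF k(2) C \<xi>(2) x])
    finally show ?thesis .
  qed
  have "(\<integral>\<omega>. smear T (zonal_series k \<xi>) \<omega> * smear T (zonal_series k' \<eta>) \<omega> \<partial>P)
      = (\<integral>x. zonal_series k \<xi> x * (\<integral>\<omega>. T x \<omega> * smear T (zonal_series k' \<eta>) \<omega> \<partial>P) \<partial>sphere_measure)"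
    by (rule expectation_smear_mult[OF cont[OF k(1) \<xi>(1)] smear_measurable smear_square_integrable];
        rule cont[OF k(2) \<xi>(2)])
  also have "\<dots> = (\<integral>x. zonal_series k \<xi> x * zonal_series (\<lambda>l. k' l * C l) x \<eta> \<partial>sphere_measure)"
    by (intro Bochner_Integration.integral_cong refl)
       (use inner zonal_series_commute in \<open>simp del: mem_sphere_0\<close>)
  also have "\<dots> = zonal_series (\<lambda>l. k l * (k' l * C l)) \<xi> \<eta>"
    by (rule zonal_series_convolution[OF k(1) zonal_summable_mult[OF k(2) C] \<xi>])
  finally show ?thesis by (simp only: mult.assoc)
qed

end

definition needlet_weight :: "real \<Rightarrow> nat \<Rightarrow> nat \<Rightarrow> nat \<Rightarrow> real" where
  "needlet_weight B p j l =
     (real (l * (l + 1)) / B ^ (2 * j)) ^ p * exp (- (real (l * (l + 1)) / B ^ (2 * j)))"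

lemma power_le_fact_exp:
  assumes "0 \<le> (y :: real)"
  shows "y ^ n \<le> fact n * exp y"
proof -
  have "(\<Sum>i\<in>{n}. y ^ i /\<^sub>R fact i) \<le> (\<Sum>i. y ^ i /\<^sub>R fact i)"
    by (rule sum_le_suminf) (use assms sums_summable[OF exp_converges[of y]] in auto)
  then have "y ^ n / fact n \<le> exp y"
    using sums_unique[OF exp_converges[of y]] by (simp add: divide_inverse mult.commute)
  then show ?thesis by (simp add: pos_divide_le_eq mult.commute)
qed

lemma needlet_weight_nonneg: "1 < B \<Longrightarrow> 0 \<le> needlet_weight B p j l"
  by (simp add: needlet_weight_def)

text \<open>With \<open>y = l (l + 1) / B\<^sup>2\<^sup>j\<close> one has \<open>y\<^sup>p\<^sup>+\<^sup>2 \<le> (p + 2)! e\<^sup>y\<close>, so the weights are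
  \<open>O(y\<^sup>-\<^sup>2) = O(l\<^sup>-\<^sup>4)\<close>, which leaves \<open>O(l\<^sup>-\<^sup>2)\<close> after the factor \<open>2 l + 1\<close>;
  the constants depend on \<open>j\<close>.\<close>

lemma zonal_summable_needlet_weight:
  assumes B: "1 < B"
  shows "zonal_summable (needlet_weight B p j)"
proof -
  define b where "b = B ^ (2 * j)"
  have b: "0 < b" using B by (simp add: b_def)
  define K where "K = fact (p + 2) * b\<^sup>2 * (3 / (4 * pi))"
  have "summable (\<lambda>l. K * inverse (real l ^ 2))"
    by (intro summable_mult inverse_power_summable) simp
  then show ?thesis
    unfolding zonal_summable_def
  proof (rule summable_comparison_test'[where N = 1])
    fix l :: nat assume l: "1 \<le> l"
    define y where "y = real (l * (l + 1)) / b"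
    have y: "0 < y" unfolding y_def using b l by (intro divide_pos_pos) (simp_all del: of_nat_mult)
    have ly: "(real l)\<^sup>2 \<le> b * y" using b by (simp add: y_def power2_eq_square)
    have "y ^ p * y\<^sup>2 \<le> fact (p + 2) * exp y"
      using power_le_fact_exp[of y "p + 2"] y by (simp only: power_add less_imp_le)
    then have "y ^ p * y\<^sup>2 * exp (- y) \<le> fact (p + 2) * exp y * exp (- y)"
      by (rule mult_right_mono) simp
    also have "\<dots> = fact (p + 2)" by (simp add: exp_minus)
    finally have w: "needlet_weight B p j l * y\<^sup>2 \<le> fact (p + 2)"
      by (simp add: needlet_weight_def y_def b_def mult_ac)
    have "needlet_weight B p j l * (real l) ^ 4 = needlet_weight B p j l * ((real l)\<^sup>2)\<^sup>2"
      by (simp flip: power_mult)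
    also have "\<dots> \<le> needlet_weight B p j l * (b * y)\<^sup>2"
      by (intro mult_left_mono power_mono ly needlet_weight_nonneg B) simp
    also have "\<dots> = b\<^sup>2 * (needlet_weight B p j l * y\<^sup>2)" by (simp add: power_mult_distrib mult_ac)
    also have "\<dots> \<le> b\<^sup>2 * fact (p + 2)" by (rule mult_left_mono[OF w]) simp
    finally have w4: "needlet_weight B p j l * real l ^ 4 \<le> b\<^sup>2 * fact (p + 2)" .
    have "needlet_weight B p j l * ((2 * real l + 1) / (4 * pi)) \<le> needlet_weight B p j l * (real l ^ 2 * (3 / (4 * pi)))"
    proof (rule mult_left_mono[OF _ needlet_weight_nonneg[OF B]])
      have "real l * 1 \<le> real l * real l" using l by (intro mult_left_mono) auto
      moreover have "1 \<le> real l" using l by simp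
      ultimately have "2 * real l + 1 \<le> 3 * real l ^ 2" unfolding power2_eq_square by linarith
      then show "(2 * real l + 1) / (4 * pi) \<le> real l ^ 2 * (3 / (4 * pi))"
        by (simp add: divide_right_mono)
    qed
    also have "\<dots> = (needlet_weight B p j l * real l ^ 4) * (3 / (4 * pi)) * inverse (real l ^ 2)"
    proof -
      have "real l ^ 4 = real l ^ 2 * real l ^ 2" by (simp flip: power_add)
      moreover have "real l ^ 2 * inverse (real l ^ 2) = 1" using l by (intro right_inverse) simp
      ultimately have "real l ^ 4 * inverse (real l ^ 2) = real l ^ 2" by (simp only: mult.assoc mult_1_right)
      from arg_cong[OF this, of "\<lambda>z. needlet_weight B p j l * (3 / (4 * pi)) * z"]
      show ?thesis by (simp only: mult_ac)
    qed
    also have "\<dots> \<le> (b\<^sup>2 * fact (p + 2)) * (3 / (4 * pi)) * inverse (real l ^ 2)"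
      by (intro mult_right_mono w4) simp_all
    finally show "norm (\<bar>needlet_weight B p j l\<bar> * ((2 * real l + 1) / (4 * pi))) \<le> K * inverse (real l ^ 2)"
      using needlet_weight_nonneg[OF B, of p j l] by (simp add: K_def mult_ac)
  qed
qed

text \<open>The hypothesis \<open>1 \<le> p\<close> enters because the needlet starts at \<open>l = 1\<close>: it makes the weight of
  \<open>l = 0\<close> vanish, so the series may start at \<open>0\<close>.\<close>

lemma mexican_needlet_eq:
  assumes B: "1 < B" and p: "1 \<le> p" and \<xi>: "\<xi> \<in> S2" and x: "x \<in> S2"
  shows "mexican_needlet B p j \<xi> w x = of_real (sqrt w * zonal_series (needlet_weight B p j) \<xi> x)"
proof -
  let ?k = "needlet_weight B p j"
  note k = zonal_summable_needlet_weight[OF B, of p j]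
  have "((\<lambda>l. complex_of_real (?k l * zonal l \<xi> x)) has_sum of_real (zonal_series ?k \<xi> x)) UNIV"
  proof (rule norm_summable_imp_has_sum)
    show "summable (\<lambda>l. norm (complex_of_real (?k l * zonal l \<xi> x)))"
      using summable_zonal[OF k \<xi> x] by (simp only: norm_of_real)
    show "(\<lambda>l. complex_of_real (?k l * zonal l \<xi> x)) sums of_real (zonal_series ?k \<xi> x)"
      by (rule sums_of_real[OF zonal_series_sums[OF k \<xi> x]])
  qed
  also have "?this \<longleftrightarrow> ((\<lambda>l. of_real ((real (l * (l + 1)) / B ^ (2 * j)) ^ p
        * exp (- (real (l * (l + 1)) / B ^ (2 * j))))
      * (\<Sum>m = - int l..int l. sph_harm l m \<xi> * cnj (sph_harm l m x)))
      has_sum of_real (zonal_series ?k \<xi> x)) {1..}"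
  proof (rule has_sum_cong_neutral)
    fix l :: nat assume "l \<in> UNIV - {1..}"
    then have "l = 0" by simp
    then have "?k l = 0" using p by (simp add: needlet_weight_def)
    then show "complex_of_real (?k l * zonal l \<xi> x) = 0" by simp
  next
    fix l :: nat
    show "complex_of_real (?k l * zonal l \<xi> x) = of_real ((real (l * (l + 1)) / B ^ (2 * j)) ^ p
        * exp (- (real (l * (l + 1)) / B ^ (2 * j))))
      * (\<Sum>m = - int l..int l. sph_harm l m \<xi> * cnj (sph_harm l m x))"
      by (simp only: sum_sph_harm_eq_zonal of_real_mult needlet_weight_def)
  qed simp
  finally show ?thesis
    unfolding mexican_needlet_def of_real_mult by (simp only: infsumI)
qed

lemma needlet_coeff_eq:
  assumes B: "1 < B" and p: "1 \<le> p" and \<xi>: "\<xi> \<in> S2"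
  shows "needlet_coeff T B p j \<xi> w \<omega> = sqrt w * smear T (zonal_series (needlet_weight B p j) \<xi>) \<omega>"
proof -
  let ?k = "needlet_weight B p j"
  have "(\<integral>x. of_real (T x \<omega>) * mexican_needlet B p j \<xi> w x \<partial>sphere_measure)
      = (\<integral>x. complex_of_real (sqrt w * (T x \<omega> * zonal_series ?k \<xi> x)) \<partial>sphere_measure)"
    by (intro Bochner_Integration.integral_cong refl)
       (simp add: mexican_needlet_eq[OF B p \<xi>] del: mem_sphere_0)
  also have "\<dots> = of_real (sqrt w * smear T (zonal_series ?k \<xi>) \<omega>)"
    unfolding integral_complex_of_real smear_def by (simp only: integral_mult_right_zero)
  finally show ?thesis unfolding needlet_coeff_def by (simp only: Re_complex_of_real)
qed

section \<open>Correlation of needlet coefficients\<close>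

lemma zonal_series_self:
  assumes "zonal_summable k" "x \<in> S2"
  shows "zonal_series k x x = (\<Sum>l. k l * ((2 * real l + 1) / (4 * pi)))"
  unfolding zonal_series_def by (simp only: zonal_self[OF assms(2)])

text \<open>The loss of covariance between \<open>x\<close> and \<open>y\<close>. It is monotone in the
  coefficients, because each zonal kernel is largest on the diagonal.\<close>

definition zonal_gap :: "(nat \<Rightarrow> real) \<Rightarrow> real^3 \<Rightarrow> real^3 \<Rightarrow> real" where
  "zonal_gap k x y = zonal_series k x x - zonal_series k x y"

lemma zonal_gap_mono:
  assumes k: "zonal_summable k" "zonal_summable k'" and le: "\<And>l. k l \<le> k' l"
    and x: "x \<in> S2" and y: "y \<in> S2"
  shows "zonal_gap k x y \<le> zonal_gap k' x y"
proof -
  have gap: "(\<lambda>l. c l * (zonal l x x - zonal l x y)) sums zonal_gap c x y" if "zonal_summable c" for c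
    unfolding zonal_gap_def right_diff_distrib
    by (intro sums_diff zonal_series_sums that x y)
  show ?thesis
  proof (rule sums_le[OF _ gap[OF k(1)] gap[OF k(2)]])
    fix l
    have "zonal l x y \<le> zonal l x x"
      using abs_zonal_le[OF x y, of l] unfolding zonal_self[OF x] by (rule abs_le_D1)
    then show "k l * (zonal l x x - zonal l x y) \<le> k' l * (zonal l x x - zonal l x y)"
      by (intro mult_right_mono le) simp
  qed
qed

lemma zonal_series_self_ge:
  assumes k: "zonal_summable k" and nonneg: "\<And>l. 0 \<le> k l" and x: "x \<in> S2"
  shows "k n * ((2 * real n + 1) / (4 * pi)) \<le> zonal_series k x x"
proof -
  have "(\<Sum>l\<in>{n}. k l * ((2 * real l + 1) / (4 * pi))) \<le> (\<Sum>l. k l * ((2 * real l + 1) / (4 * pi)))"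
  proof (rule sum_le_suminf)
    show "summable (\<lambda>l. k l * ((2 * real l + 1) / (4 * pi)))"
      using k unfolding zonal_summable_def abs_of_nonneg[OF nonneg] .
  qed (use nonneg in \<open>simp_all\<close>)
  then show ?thesis unfolding zonal_series_self[OF k x] by simp
qed

lemma zonal_summable_scale: "zonal_summable k \<Longrightarrow> zonal_summable (\<lambda>l. c * k l)"
  unfolding zonal_summable_def abs_mult mult.assoc by (rule summable_mult)

lemma zonal_series_scale:
  assumes "zonal_summable k" "x \<in> S2" "y \<in> S2"
  shows "zonal_series (\<lambda>l. c * k l) x y = c * zonal_series k x y"
  using sums_unique[OF sums_mult[OF zonal_series_sums[OF assms], of c]]
  unfolding zonal_series_def by (simp only: mult.assoc)

text \<open>The gap is continuous on the compact space \<open>S\<^sup>2 \<times> S\<^sup>2\<close> and vanishes on the diagonal.\<close>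

lemma zonal_gap_uniformly_small:
  assumes k: "zonal_summable k" and e: "0 < (e :: real)"
  shows "\<exists>d>0. \<forall>x\<in>S2. \<forall>y\<in>S2. dist x y < d \<longrightarrow> zonal_gap k x y < e"
proof -
  have "continuous_on (S2 \<times> S2) (\<lambda>z. zonal_gap k (fst z) (snd z))"
    unfolding zonal_gap_def
    by (intro continuous_on_diff continuous_on_zonal_series[OF k] continuous_intros) auto
  moreover have "compact (S2 \<times> S2)" by (intro compact_Times compact_sphere)
  ultimately have "uniformly_continuous_on (S2 \<times> S2) (\<lambda>z. zonal_gap k (fst z) (snd z))"
    by (rule compact_uniformly_continuous)
  then obtain d where d: "0 < d" and *: "\<And>z z'. z \<in> S2 \<times> S2 \<Longrightarrow> z' \<in> S2 \<times> S2 \<Longrightarrow> dist z' z < d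
      \<Longrightarrow> dist (zonal_gap k (fst z') (snd z')) (zonal_gap k (fst z) (snd z)) < e"
    using e unfolding uniformly_continuous_on_def by meson
  show ?thesis
  proof (intro exI[of _ d] conjI d ballI impI)
    fix x y assume xy: "x \<in> S2" "y \<in> S2" "dist x y < d"
    have "dist (x, y) (x, x) < d" using xy(3) by (simp add: dist_Pair_Pair dist_commute)
    then have "dist (zonal_gap k x y) (zonal_gap k x x) < e"
      using *[of "(x, x)" "(x, y)"] xy(1,2) by (simp only: fst_conv snd_conv mem_Times_iff simp_thms)
    then show "zonal_gap k x y < e" by (simp add: zonal_gap_def dist_real_def)
  qed
qed

text \<open>A chord is shorter than its arc: \<open>\<parallel>x - y\<parallel>\<^sup>2 = 2 - 2 cos \<theta> = 4 sin\<^sup>2 (\<theta> / 2) \<le> \<theta>\<^sup>2\<close>.\<close>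

lemma dist_le_sphere_dist:
  assumes x: "x \<in> S2" and y: "y \<in> S2"
  shows "dist x y \<le> sphere_dist x y"
proof -
  define \<theta> where "\<theta> = sphere_dist x y"
  have n: "norm x = 1" "norm y = 1" using x y by auto
  then have "\<bar>x \<bullet> y\<bar> \<le> 1" using Cauchy_Schwarz_ineq2[of x y] by simp
  then have cos: "cos \<theta> = x \<bullet> y" and \<theta>: "0 \<le> \<theta>"
    by (auto simp: \<theta>_def sphere_dist_def intro!: cos_arccos_abs arccos_lbound)
  have "(dist x y)\<^sup>2 = 2 - 2 * cos \<theta>"
    using n by (simp add: dist_norm cos power2_norm_eq_inner inner_diff inner_commute
        norm_eq_1)
  also have "\<dots> = 4 * (sin (\<theta> / 2))\<^sup>2" using cos_double_sin[of "\<theta> / 2"] by simp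
  also have "\<dots> \<le> 4 * (\<theta> / 2)\<^sup>2"
  proof -
    have "\<bar>sin (\<theta> / 2)\<bar> \<le> \<bar>\<theta> / 2\<bar>" by (rule abs_sin_x_le_abs_x)
    then have "(sin (\<theta> / 2))\<^sup>2 \<le> (\<theta> / 2)\<^sup>2" by (rule abs_le_square_iff[THEN iffD1])
    then show ?thesis by (rule mult_left_mono) simp
  qed
  also have "\<dots> = \<theta>\<^sup>2" by (simp add: power_divide)
  finally show ?thesis using \<theta> unfolding \<theta>_def[symmetric] by (rule power2_le_imp_le)
qed

text \<open>The windows \<open>(B\<^sup>j\<^sup>-\<^sup>1, B\<^sup>j\<^sup>+\<^sup>1)\<close> with \<open>j \<ge> 1\<close> cover every \<open>l \<ge> 2\<close>; the degrees \<open>0\<close> and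
  \<open>1\<close> lie in none of them.\<close>

lemma regular_at_spectrum_bound:
  assumes reg: "regular_at B \<alpha> M C g c" and B: "1 < B" and l: "2 \<le> l"
  shows "0 < C l" "C l \<le> c 0 * real l powr (- \<alpha>)" "0 < c 0"
proof -
  obtain n where n: "real l \<le> B ^ n" using real_arch_pow[OF B, of "real l"] less_imp_le by blast
  \<comment> \<open>the least \<open>j\<close> with \<open>l \<le> B\<^sup>j\<close> puts \<open>l\<close> into the window of \<open>j\<close>; it is positive since \<open>l > 1\<close>\<close>
  define j where "j = (LEAST n. real l \<le> B ^ n)"
  have j: "real l \<le> B ^ j" unfolding j_def by (rule LeastI[where P = "\<lambda>n. real l \<le> B ^ n", OF n])
  have "j \<noteq> 0" using j l by (intro notI) simp
  then have j1: "1 \<le> j" by simp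
  have "\<not> real l \<le> B ^ (j - 1)"
    using \<open>j \<noteq> 0\<close> not_less_Least[of "j - 1" "\<lambda>n. real l \<le> B ^ n"] unfolding j_def[symmetric] by auto
  then have low: "B ^ (j - 1) < real l" by simp
  have "B ^ j < B ^ (j + 1)" using B by (intro power_strict_increasing) auto
  then have high: "real l < B ^ (j + 1)" using j by simp
  have "B ^ j = B ^ (j - 1) * B" using j1 by (metis Suc_diff_1 Suc_le_lessD One_nat_def power_Suc2)
  then have u: "real l / B ^ j \<in> {1 / B..B}"
    using low high B by (auto simp: divide_simps mult_ac)
  from reg have C: "C l = real l powr (- \<alpha>) * g j (real l / B ^ j)" and pos: "0 < C l"
    and gc: "g j (real l / B ^ j) \<le> c 0"
    using j1 low high u unfolding regular_at_def by blast+
  show "0 < C l" by (rule pos)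
  show "C l \<le> c 0 * real l powr (- \<alpha>)"
    unfolding C by (subst mult.commute, rule mult_right_mono[OF gc]) simp
  show "0 < c 0" using reg unfolding regular_at_def by blast
qed

text \<open>The terms are \<open>O(l\<^sup>4\<^sup>p \<cdot> l\<^sup>-\<^sup>\<alpha> \<cdot> l)\<close>, and \<open>4 p + 1 - \<alpha> < -1\<close> is exactly the hypothesis on \<open>\<alpha>\<close>.
  It says that the variance of a rescaled coefficient comes from low degrees.\<close>

lemma zonal_summable_limit_weight:
  assumes reg: "regular_at B \<alpha> M C g c" and B: "1 < B" and \<alpha>: "4 * real p + 2 < \<alpha>"
  shows "zonal_summable (\<lambda>l. real (l * (l + 1)) ^ (2 * p) * C l)"
proof -
  define K where "K = c 0 * 2 ^ (2 * p) * (3 / (4 * pi))"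
  have "summable (\<lambda>l. real l powr (4 * real p + 1 - \<alpha>))"
    using \<alpha> by (simp add: summable_real_powr_iff)
  then have "summable (\<lambda>l. K * real l powr (4 * real p + 1 - \<alpha>))" by (rule summable_mult)
  then show ?thesis
    unfolding zonal_summable_def
  proof (rule summable_comparison_test'[where N = 2])
    fix l :: nat assume l: "2 \<le> l"
    note C = regular_at_spectrum_bound[OF reg B l]
    have "real l + 1 \<le> 2 * real l" using l by simp
    then have "real l * (real l + 1) \<le> real l * (2 * real l)" by (intro mult_left_mono) auto
    moreover have "real (l * (l + 1)) = real l * (real l + 1)" by (simp add: algebra_simps)
    ultimately have "real (l * (l + 1)) \<le> 2 * real l ^ 2"
      by (simp only: power2_eq_square mult.left_commute)
    then have "real (l * (l + 1)) ^ (2 * p) \<le> (2 * real l ^ 2) ^ (2 * p)"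
      by (rule power_mono) simp
    also have "\<dots> = 2 ^ (2 * p) * real l powr (4 * real p)"
    proof -
      have "(real l ^ 2) ^ (2 * p) = real l powr real (2 * (2 * p))"
        using l by (subst powr_realpow) (auto simp flip: power_mult)
      then show ?thesis by (simp add: power_mult_distrib mult.assoc)
    qed
    finally have 1: "real (l * (l + 1)) ^ (2 * p) \<le> 2 ^ (2 * p) * real l powr (4 * real p)" .
    have 2: "(2 * real l + 1) / (4 * pi) \<le> 3 / (4 * pi) * real l powr 1"
    proof -
      have "2 * real l + 1 \<le> 3 * real l" using l by simp
      then have "(2 * real l + 1) / (4 * pi) \<le> (3 * real l) / (4 * pi)"
        by (rule divide_right_mono) simp
      then show ?thesis using l by simp
    qed
    have "real (l * (l + 1)) ^ (2 * p) * C l * ((2 * real l + 1) / (4 * pi))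
      \<le> (2 ^ (2 * p) * real l powr (4 * real p)) * (c 0 * real l powr (- \<alpha>)) * (3 / (4 * pi) * real l powr 1)"
      using C by (intro mult_mono 1 2 C(2)) (simp_all del: of_nat_mult)
    also have "\<dots> = K * (real l powr (4 * real p) * real l powr (- \<alpha>) * real l powr 1)"
      by (simp only: K_def mult_ac)
    also have "real l powr (4 * real p) * real l powr (- \<alpha>) * real l powr 1 = real l powr (4 * real p + 1 - \<alpha>)"
      unfolding powr_add[symmetric] by (rule arg_cong[where f = "(powr) (real l)"]) simp
    finally show "norm (\<bar>real (l * (l + 1)) ^ (2 * p) * C l\<bar> * ((2 * real l + 1) / (4 * pi)))
        \<le> K * real l powr (4 * real p + 1 - \<alpha>)"
      using C(1) by (simp del: of_nat_mult add: abs_mult)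
  qed
qed

text \<open>The quadrature weights cancel, and the variance is the same at every point of the sphere, since
  the diagonal of a zonal series is constant.\<close>

lemma (in isotropic_field) Corr_needlet_coeff:
  fixes j :: nat
  assumes B: "1 < B" and p: "1 \<le> p" and \<xi>: "\<xi> \<in> S2" "\<eta> \<in> S2" and w: "0 < w" "0 < w'"
  defines "K \<equiv> \<lambda>l. needlet_weight B p j l * needlet_weight B p j l * C l"
  shows "Corr P (needlet_coeff T B p j \<xi> w) (needlet_coeff T B p j \<eta> w')
      = zonal_series K \<xi> \<eta> / zonal_series K \<xi> \<xi>"
proof -
  let ?k = "needlet_weight B p j"
  note k = zonal_summable_needlet_weight[OF B, of p j]
  have K: "zonal_summable K"
    unfolding K_def by (intro zonal_summable_mult k zonal_summable_spectrum)
  have mom: "(\<integral>\<omega>. needlet_coeff T B p j x v \<omega> * needlet_coeff T B p j y v' \<omega> \<partial>P)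
      = sqrt v * sqrt v' * zonal_series K x y" if "x \<in> S2" "y \<in> S2" for x y v v'
  proof -
    have "(\<integral>\<omega>. needlet_coeff T B p j x v \<omega> * needlet_coeff T B p j y v' \<omega> \<partial>P)
      = (\<integral>\<omega>. sqrt v * sqrt v' * (smear T (zonal_series ?k x) \<omega> * smear T (zonal_series ?k y) \<omega>) \<partial>P)"
      by (intro Bochner_Integration.integral_cong refl)
         (simp only: needlet_coeff_eq[OF B p that(1)] needlet_coeff_eq[OF B p that(2)] mult_ac)
    then show ?thesis
      by (simp only: integral_mult_right_zero expectation_smear_zonal_series[OF k k that] K_def)
  qed
  have self: "zonal_series K \<eta> \<eta> = zonal_series K \<xi> \<xi>"
    by (simp only: zonal_series_self[OF K \<xi>(1)] zonal_series_self[OF K \<xi>(2)])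
  have K0: "0 \<le> K l" for l unfolding K_def using power_spectrum_nonneg by simp
  have "0 \<le> K 0 * ((2 * real 0 + 1) / (4 * pi))" by (intro mult_nonneg_nonneg K0) simp
  also have "\<dots> \<le> zonal_series K \<xi> \<xi>" by (rule zonal_series_self_ge[OF K K0 \<xi>(1)])
  finally have nn: "0 \<le> zonal_series K \<xi> \<xi>" .
  have sq: "(\<integral>\<omega>. (needlet_coeff T B p j x v \<omega>)\<^sup>2 \<partial>P) = v * zonal_series K x x"
    if "x \<in> S2" "0 < v" for x v
    using mom[OF that(1,1), of v v] that(2) by (simp add: power2_eq_square)
  have "sqrt ((w * zonal_series K \<xi> \<xi>) * (w' * zonal_series K \<xi> \<xi>))
      = sqrt w * sqrt w' * zonal_series K \<xi> \<xi>"
    using nn by (simp add: real_sqrt_mult)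
  then show ?thesis
    unfolding Corr_def mom[OF \<xi>] sq[OF \<xi>(1) w(1)] sq[OF \<xi>(2) w(2)] self
    using w by simp
qed

text \<open>A lower bound that is uniform in \<open>j\<close>. Up to the factor \<open>B\<^sup>-\<^sup>4\<^sup>p\<^sup>j\<close>, which cancels, the spectrum of
  a coefficient is \<open>u\<^sub>l e\<^sup>-\<^sup>2\<^sup>y\<close> with \<open>y = l (l + 1) / B\<^sup>2\<^sup>j\<close>. The gap in the numerator is estimated
  by dropping the exponential. The variance in the denominator is estimated by its term \<open>l = 2\<close>, the
  first degree at which the power spectrum is known to be positive: the exponent there is
  \<open>2 \<cdot> 6 / B\<^sup>2\<^sup>j \<le> 12\<close>, and \<open>5 = 2 l + 1\<close>.\<close>

lemma (in isotropic_field) Corr_needlet_coeff_ge: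
  fixes j :: nat
  assumes B: "1 < B" and p: "1 \<le> p" and \<xi>: "\<xi> \<in> S2" "\<eta> \<in> S2" and w: "0 < w" "0 < w'"
    and C2: "0 < C 2"
  defines "u \<equiv> \<lambda>l. real (l * (l + 1)) ^ (2 * p) * C l"
  assumes u: "zonal_summable u"
  shows "1 - zonal_gap u \<xi> \<eta> / (u 2 * exp (- 12) * (5 / (4 * pi)))
      \<le> Corr P (needlet_coeff T B p j \<xi> w) (needlet_coeff T B p j \<eta> w')"
proof -
  define K where "K = (\<lambda>l. needlet_weight B p j l * needlet_weight B p j l * C l)"
  define b where "b = B ^ (2 * j)"
  define s where "s = (1 / b) ^ (2 * p)"
  have b: "1 \<le> b" using B by (simp add: b_def)
  have s: "0 < s" using b by (simp add: s_def)
  have K: "zonal_summable K"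
    unfolding K_def by (intro zonal_summable_mult zonal_summable_needlet_weight B zonal_summable_spectrum)
  have K_eq: "K l = s * u l * exp (- (2 * real (l * (l + 1)) / b))" for l
  proof -
    define y where "y = real (l * (l + 1))"
    have "exp (- (y / b)) * exp (- (y / b)) = exp (- (2 * y / b))" by (simp flip: exp_add)
    moreover have "(y / b) ^ p * (y / b) ^ p = s * y ^ (2 * p)"
      by (simp add: s_def power_divide mult_2 power_add)
    moreover have "K l = ((y / b) ^ p * (y / b) ^ p) * (exp (- (y / b)) * exp (- (y / b))) * C l"
      unfolding K_def needlet_weight_def b_def y_def by (simp only: mult_ac)
    ultimately show ?thesis unfolding u_def y_def[symmetric] by (simp only: mult_ac)
  qed
  have u0: "0 \<le> u l" for l using power_spectrum_nonneg by (simp add: u_def)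
  have K0: "0 \<le> K l" for l unfolding K_def using power_spectrum_nonneg by simp
  have K_le: "K l \<le> s * u l" for l
    unfolding K_eq using s u0[of l] b by (intro mult_right_le_one_le) (simp_all del: of_nat_mult)
  have u2: "0 < u 2" using C2 by (simp add: u_def)
  let ?m = "u 2 * exp (- 12) * (5 / (4 * pi))"
  have m: "0 < ?m" using u2 by simp
  have "s * ?m \<le> K 2 * ((2 * real 2 + 1) / (4 * pi))"
  proof -
    have "exp (- 12) \<le> exp (- (2 * real (2 * (2 + 1)) / b))" using b by (simp add: divide_simps)
    then have "s * u 2 * exp (- 12) \<le> K 2"
      unfolding K_eq using s u2 by (intro mult_left_mono) simp_all
    then have "s * u 2 * exp (- 12) * (5 / (4 * pi)) \<le> K 2 * (5 / (4 * pi))"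
      by (rule mult_right_mono) simp
    then show ?thesis by (simp add: mult.assoc)
  qed
  also have "\<dots> \<le> zonal_series K \<xi> \<xi>" by (rule zonal_series_self_ge[OF K K0 \<xi>(1)])
  finally have den: "s * ?m \<le> zonal_series K \<xi> \<xi>" .
  have "zonal_gap K \<xi> \<eta> \<le> zonal_gap (\<lambda>l. s * u l) \<xi> \<eta>"
    by (intro zonal_gap_mono K zonal_summable_scale u K_le \<xi>)
  also have "\<dots> = s * zonal_gap u \<xi> \<eta>"
    unfolding zonal_gap_def zonal_series_scale[OF u \<xi>(1,1)] zonal_series_scale[OF u \<xi>]
    by (simp only: right_diff_distrib)
  finally have num: "zonal_gap K \<xi> \<eta> \<le> s * zonal_gap u \<xi> \<eta>" .
  \<comment> \<open>by comparison with the coefficients that vanish identically\<close>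
  have gap_u: "0 \<le> zonal_gap u \<xi> \<eta>"
  proof -
    have "zonal_summable (\<lambda>l. 0)" by (simp add: zonal_summable_def)
    from zonal_gap_mono[OF this u u0 \<xi>] show ?thesis by (simp add: zonal_gap_def zonal_series_def)
  qed
  have pos: "0 < zonal_series K \<xi> \<xi>" using den s m by (meson less_le_trans mult_pos_pos)
  have "zonal_gap K \<xi> \<eta> / zonal_series K \<xi> \<xi> \<le> (s * zonal_gap u \<xi> \<eta>) / (s * ?m)"
    by (rule frac_le[OF mult_nonneg_nonneg[OF less_imp_le[OF s] gap_u] num mult_pos_pos[OF s m] den])
  also have "\<dots> = zonal_gap u \<xi> \<eta> / ?m" using s by simp
  finally have "1 - zonal_gap u \<xi> \<eta> / ?m \<le> 1 - zonal_gap K \<xi> \<eta> / zonal_series K \<xi> \<xi>" by simp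
  also have "\<dots> = zonal_series K \<xi> \<eta> / zonal_series K \<xi> \<xi>"
    using pos by (simp add: zonal_gap_def diff_divide_distrib)
  also have "\<dots> = Corr P (needlet_coeff T B p j \<xi> w) (needlet_coeff T B p j \<eta> w')"
    unfolding K_def by (rule Corr_needlet_coeff[OF B p \<xi> w, symmetric])
  finally show ?thesis .
qed

theorem theorem6:
  fixes P :: "'w measure"
    and T :: "real^3 \<Rightarrow> 'w \<Rightarrow> real"
    and a :: "nat \<Rightarrow> int \<Rightarrow> 'w \<Rightarrow> complex"
    and C :: "nat \<Rightarrow> real"
    and B \<alpha> :: real
    and p M :: nat
    and g :: "nat \<Rightarrow> real \<Rightarrow> real"
    and c :: "nat \<Rightarrow> real"
    and N :: "nat \<Rightarrow> nat"
    and \<xi> :: "nat \<Rightarrow> nat \<Rightarrow> real^3"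
    and w :: "nat \<Rightarrow> nat \<Rightarrow> real"
  assumes "1 < B" and "1 \<le> p"
    and "isotropic_field P T a C"
    and "2 < \<alpha>"
    and "regular_spectrum \<alpha> M C"
    and "regular_at B \<alpha> M C g c"
    and "\<And>j k. 1 \<le> j \<Longrightarrow> k < N j \<Longrightarrow> \<xi> j k \<in> S2 \<and> 0 < w j k"
    and "4 * real p + 2 < \<alpha>"
  shows "\<forall>\<epsilon>\<in>{0<..<1}. \<exists>\<delta>>0.
           \<delta> \<le> \<epsilon> * (1 + (c 0)\<^sup>2) powr (- (1 / (\<alpha> - 4 * real p - 2))) \<and>
           (\<forall>k k'. (\<forall>j\<ge>1. k j < N j \<and> k' j < N j \<and>
                       sphere_dist (\<xi> j (k j)) (\<xi> j (k' j)) \<le> \<delta>) \<longrightarrow>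
              liminf (\<lambda>j. ereal (Corr P
                  (needlet_coeff T B p j (\<xi> j (k j)) (w j (k j)))
                  (needlet_coeff T B p j (\<xi> j (k' j)) (w j (k' j)))))
                > ereal (1 - \<epsilon>))"
proof
  fix \<epsilon> :: real assume \<epsilon>: "\<epsilon> \<in> {0<..<1}"
  interpret isotropic_field P T a C by fact
  define u where "u = (\<lambda>l. real (l * (l + 1)) ^ (2 * p) * C l)"
  have u: "zonal_summable u"
    unfolding u_def by (rule zonal_summable_limit_weight[OF assms(6,1,8)])
  have C2: "0 < C 2" by (rule regular_at_spectrum_bound(1)[OF assms(6,1)]) simp
  let ?m = "u 2 * exp (- 12) * (5 / (4 * pi))"
  have m: "0 < ?m" using C2 by (simp add: u_def)
  obtain d where d: "0 < d"
    and gap: "\<And>x y. x \<in> S2 \<Longrightarrow> y \<in> S2 \<Longrightarrow> dist x y < d \<Longrightarrow> zonal_gap u x y < \<epsilon> / 2 * ?m"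
    using zonal_gap_uniformly_small[OF u, of "\<epsilon> / 2 * ?m"] \<epsilon> m by (metis greaterThanLessThan_iff half_gt_zero mult_pos_pos)
  let ?\<delta>0 = "\<epsilon> * (1 + (c 0)\<^sup>2) powr (- (1 / (\<alpha> - 4 * real p - 2)))"
  have "0 < 1 + (c 0)\<^sup>2" by (simp add: add_pos_nonneg)
  then have \<delta>0: "0 < ?\<delta>0" using \<epsilon> by simp
  \<comment> \<open>half of \<open>d\<close>, because the points may be at distance exactly \<open>\<delta>\<close>\<close>
  define \<delta> where "\<delta> = min (d / 2) ?\<delta>0"
  show "\<exists>\<delta>>0. \<delta> \<le> ?\<delta>0 \<and>
           (\<forall>k k'. (\<forall>j\<ge>1. k j < N j \<and> k' j < N j \<and>
                       sphere_dist (\<xi> j (k j)) (\<xi> j (k' j)) \<le> \<delta>) \<longrightarrow>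
              liminf (\<lambda>j. ereal (Corr P
                  (needlet_coeff T B p j (\<xi> j (k j)) (w j (k j)))
                  (needlet_coeff T B p j (\<xi> j (k' j)) (w j (k' j)))))
                > ereal (1 - \<epsilon>))"
  proof (intro exI[of _ \<delta>] conjI allI impI)
    show "0 < \<delta>" "\<delta> \<le> ?\<delta>0" using d \<delta>0 by (simp_all add: \<delta>_def)
    fix k k' assume kk: "\<forall>j\<ge>1. k j < N j \<and> k' j < N j \<and> sphere_dist (\<xi> j (k j)) (\<xi> j (k' j)) \<le> \<delta>"
    let ?Corr = "\<lambda>j. Corr P (needlet_coeff T B p j (\<xi> j (k j)) (w j (k j)))
                  (needlet_coeff T B p j (\<xi> j (k' j)) (w j (k' j)))"
    have "1 - \<epsilon> / 2 \<le> ?Corr j" if j: "1 \<le> j" for j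
    proof -
      have k: "k j < N j" "k' j < N j" and near: "sphere_dist (\<xi> j (k j)) (\<xi> j (k' j)) \<le> \<delta>"
        using kk j by blast+
      have S: "\<xi> j (k j) \<in> S2" "\<xi> j (k' j) \<in> S2" and W: "0 < w j (k j)" "0 < w j (k' j)"
        using assms(7)[OF j k(1)] assms(7)[OF j k(2)] by blast+
      have "dist (\<xi> j (k j)) (\<xi> j (k' j)) \<le> \<delta>"
        by (rule order_trans[OF dist_le_sphere_dist[OF S] near])
      also have "\<delta> < d" using d by (simp add: \<delta>_def min_less_iff_disj)
      finally have "zonal_gap u (\<xi> j (k j)) (\<xi> j (k' j)) < \<epsilon> / 2 * ?m" by (rule gap[OF S])
      then have "zonal_gap u (\<xi> j (k j)) (\<xi> j (k' j)) / ?m \<le> \<epsilon> / 2"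
        by (subst pos_divide_le_eq[OF m]) (rule less_imp_le)
      then have "1 - \<epsilon> / 2 \<le> 1 - zonal_gap u (\<xi> j (k j)) (\<xi> j (k' j)) / ?m" by linarith
      also have "\<dots> \<le> ?Corr j"
        using Corr_needlet_coeff_ge[OF assms(1,2) S W C2 u[unfolded u_def], of j] unfolding u_def .
      finally show ?thesis .
    qed
    then have "\<forall>\<^sub>F j in sequentially. ereal (1 - \<epsilon> / 2) \<le> ereal (?Corr j)"
      unfolding eventually_sequentially ereal_less_eq by blast
    then have "ereal (1 - \<epsilon> / 2) \<le> liminf (\<lambda>j. ereal (?Corr j))" by (rule Liminf_bounded)
    moreover have "ereal (1 - \<epsilon>) < ereal (1 - \<epsilon> / 2)" using \<epsilon> by simp
    ultimately show "ereal (1 - \<epsilon>) < liminf (\<lambda>j. ereal (?Corr j))" by (rule less_le_trans[rotated])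
  qed
qed

end
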